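(* Let $\lambda=(\lambda_1,\dots,\lambda_s)$ be a partition of $n$ and let $\mu=(k+1,1^{n-k-1})$ with $k\le s-1$. Then \[ \mathrm{F}_{\mu\lambda}(q)=(q-1)^kq^{\binom{n}{2}-\binom{n-k}{2}-k}\sum_{j=2}^{s-k+1}[\lambda_1+\dots+\lambda_{j-1}]_{1/q}\sum_{A\subseteq\{2,\dots,s\},\ |A|=k,\ \min A=j}\ \prod_{i\in A}[\lambda_i]_{1/q}. \]
   Context: For a prime power $q$, $\mathfrak{u}_\lambda(\mathbb{F}_q)$ is the nilradical of the standard parabolic subalgebra of $\mathfrak{gl}_n(\mathbb{F}_q)$ with diagonal blocks of sizes $\lambda_1,\dots,\lambda_s$; $J_\mu$ the nilpotent Jordan matrix of type $\mu$; $\mathcal{C}_\mu$ its $\mathrm{GL}_n(\mathbb{F}_q)$-conjugacy class; $\mathrm{F}_{\mu\lambda}(q)=|\mathcal{C}_\mu\cap\mathfrak{u}_\lambda(\mathbb{F}_q)|$. $[m]_{1/q}=(q^{-m}-1)/(q^{-1}-1)=q^{1-m}(q^m-1)/(q-1)$.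
   Formalization: The formal statement assumes k ≥ 1; for k = 0 (μ = (1^n)) the left side is 1, while on the right min A is undefined for the empty set A (an empty sum gives 0), so the formula as written fails there. *)

theory Defs
  imports Jordan_Normal_Form.Jordan_Normal_Form
begin

definition is_partition_of :: "nat list \<Rightarrow> nat \<Rightarrow> bool" where
  "is_partition_of lam n \<longleftrightarrow>
     sorted_wrt (\<ge>) lam \<and> (\<forall>x\<in>set lam. 0 < x) \<and> sum_list lam = n"

definition q_bracket :: "real \<Rightarrow> nat \<Rightarrow> real" where
  "q_bracket x m = (x ^ m - 1) / (x - 1)"

definition nilpotent_jordan :: "nat list \<Rightarrow> 'a::field mat" where
  "nilpotent_jordan mu = jordan_matrix (map (\<lambda>m. (m, 0)) mu)"

definition nilpotent_class :: "nat list \<Rightarrow> 'a::field mat set" where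
  "nilpotent_class mu = {X. similar_mat X (nilpotent_jordan mu)}"

text \<open>Rows and columns of matrices are indexed from \<open>0\<close>, and so are the diagonal blocks:
  block \<open>t\<close> consists of the \<open>i\<close> with
  \<open>lam ! 0 + \<dots> + lam ! (t - 1) \<le> i < lam ! 0 + \<dots> + lam ! t\<close>.\<close>

definition block_index :: "nat list \<Rightarrow> nat \<Rightarrow> nat" where
  "block_index lam i = (LEAST t. i < sum_list (take (Suc t) lam))"

definition standard_parabolic :: "nat list \<Rightarrow> 'a::field mat set" where
  "standard_parabolic lam =
     {X \<in> carrier_mat (sum_list lam) (sum_list lam).
        \<forall>i<sum_list lam. \<forall>j<sum_list lam.
          \<not> block_index lam i \<le> block_index lam j \<longrightarrow> X $$ (i, j) = 0}"

text \<open>The nilradical is the Lie algebra of the unipotent radical of the parabolic subgroup, that is,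
  the strictly block upper triangular matrices. (The largest nilpotent ideal of the Lie algebra
  would also contain the scalar matrices.) It is the largest Lie ideal of the parabolic subalgebra
  that consists of nilpotent matrices; see \<open>parabolic_nilradical_nil_ideal\<close> and
  \<open>parabolic_nilradical_largest\<close> below.\<close>

definition parabolic_nilradical :: "nat list \<Rightarrow> 'a::field mat set" where
  "parabolic_nilradical lam =
     {X \<in> carrier_mat (sum_list lam) (sum_list lam).
        \<forall>i<sum_list lam. \<forall>j<sum_list lam.
          \<not> block_index lam i < block_index lam j \<longrightarrow> X $$ (i, j) = 0}"

definition F_count :: "'a::{field,finite} itself \<Rightarrow> nat list \<Rightarrow> nat list \<Rightarrow> nat" where
  "F_count _ mu lam = card ((nilpotent_class mu :: 'a mat set) \<inter> parabolic_nilradical lam)"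

definition nil_lie_ideal :: "nat \<Rightarrow> 'a::field mat set \<Rightarrow> 'a mat set \<Rightarrow> bool" where
  "nil_lie_ideal n L I \<longleftrightarrow>
     I \<subseteq> L \<and> 0\<^sub>m n n \<in> I \<and> (\<forall>X\<in>I. \<forall>Y\<in>I. X + Y \<in> I) \<and> (\<forall>c. \<forall>X\<in>I. c \<cdot>\<^sub>m X \<in> I) \<and>
     (\<forall>Y\<in>L. \<forall>X\<in>I. Y * X - X * Y \<in> I) \<and> (\<forall>X\<in>I. \<exists>m. X ^\<^sub>m m = 0\<^sub>m n n)"

lemma block_index_mono:
  assumes "i \<le> j" "j < sum_list lam"
  shows "block_index lam i \<le> block_index lam j"
proof -
  have "\<exists>t. j < sum_list (take (Suc t) lam)"
    using assms(2) by (intro exI[of _ "length lam"]) simp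
  then have "j < sum_list (take (Suc (block_index lam j)) lam)"
    unfolding block_index_def by (rule LeastI_ex)
  with assms(1) show ?thesis
    unfolding block_index_def[of lam i] by (intro Least_le) simp
qed

lemma index_mat_mult_sum:
  assumes "A \<in> carrier_mat n n" "B \<in> carrier_mat n n" "i < n" "j < n"
  shows "(A * B) $$ (i, j) = (\<Sum>l<n. A $$ (i, l) * B $$ (l, j))"
  using assms by (auto simp: scalar_prod_def lessThan_atLeast0)

lemma strictly_upper_nilpotent:
  assumes X: "(X::'a::field mat) \<in> carrier_mat n n"
    and su: "\<And>i j. i < n \<Longrightarrow> j < n \<Longrightarrow> j \<le> i \<Longrightarrow> X $$ (i, j) = 0"
  shows "X ^\<^sub>m n = 0\<^sub>m n n"
proof -
  have "\<forall>i<n. \<forall>j<n. j < i + m \<longrightarrow> (X ^\<^sub>m m) $$ (i, j) = 0" for m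
  proof (induction m)
    case 0
    then show ?case using X by auto
  next
    case (Suc m)
    show ?case
    proof (intro allI impI)
      fix i j assume ij: "i < n" "j < n" "j < i + Suc m"
      have "(X ^\<^sub>m m) $$ (i, l) * X $$ (l, j) = 0" if "l < n" for l
        using Suc.IH su ij that by (cases "l < i + m") auto
      then show "(X ^\<^sub>m Suc m) $$ (i, j) = 0"
        using index_mat_mult_sum[of "X ^\<^sub>m m" n X i j] X ij by (auto intro!: sum.neutral)
    qed
  qed
  from this[of n] show ?thesis using X by (intro eq_matI) auto
qed

lemma two_step_row_not_nilpotent:
  assumes Z: "(Z::'a::field mat) \<in> carrier_mat n n" and ij: "i < n" "j < n" "i \<noteq> j"
    and nz: "Z $$ (i, j) \<noteq> 0" "Z $$ (j, i) \<noteq> 0"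
    and zero: "\<And>l. l < n \<Longrightarrow> l \<noteq> j \<Longrightarrow> Z $$ (i, l) = 0" "\<And>l. l < n \<Longrightarrow> l \<noteq> i \<Longrightarrow> Z $$ (j, l) = 0"
  shows "Z ^\<^sub>m m \<noteq> 0\<^sub>m n n"
proof -
  have P: "Z ^\<^sub>m m \<in> carrier_mat n n" for m using Z by auto
  have "(\<forall>l<n. l \<noteq> i \<and> l \<noteq> j \<longrightarrow> (Z ^\<^sub>m m) $$ (i, l) = 0) \<and>
        ((Z ^\<^sub>m m) $$ (i, i) \<noteq> 0 \<or> (Z ^\<^sub>m m) $$ (i, j) \<noteq> 0)" for m
  proof (induction m)
    case 0
    then show ?case using Z ij by auto
  next
    case (Suc m)
    have eq: "(Z ^\<^sub>m Suc m) $$ (i, l) = (Z ^\<^sub>m m) $$ (i, i) * Z $$ (i, l) + (Z ^\<^sub>m m) $$ (i, j) * Z $$ (j, l)"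
      if l: "l < n" for l
    proof -
      have "(Z ^\<^sub>m Suc m) $$ (i, l) = (\<Sum>r<n. (Z ^\<^sub>m m) $$ (i, r) * Z $$ (r, l))"
        using index_mat_mult_sum[OF P Z ij(1) l] by simp
      also have "\<dots> = (\<Sum>r\<in>{i, j}. (Z ^\<^sub>m m) $$ (i, r) * Z $$ (r, l))"
        by (rule sum.mono_neutral_right) (use ij Suc.IH in auto)
      finally show ?thesis using ij by simp
    qed
    have "(Z ^\<^sub>m Suc m) $$ (i, i) \<noteq> 0 \<or> (Z ^\<^sub>m Suc m) $$ (i, j) \<noteq> 0"
      unfolding eq[OF ij(1)] eq[OF ij(2)] using zero ij nz Suc.IH by auto
    moreover have "\<forall>l<n. l \<noteq> i \<and> l \<noteq> j \<longrightarrow> (Z ^\<^sub>m Suc m) $$ (i, l) = 0"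
      using eq zero by auto
    ultimately show ?case by blast
  qed
  from this[of m] show ?thesis using ij by auto
qed

lemma upper_triangular_not_nilpotent:
  assumes X: "(X::'a::field mat) \<in> carrier_mat n n"
    and ut: "\<And>i j. i < n \<Longrightarrow> j < i \<Longrightarrow> X $$ (i, j) = 0"
    and i: "i < n" "X $$ (i, i) \<noteq> 0"
  shows "X ^\<^sub>m m \<noteq> 0\<^sub>m n n"
proof -
  have P: "X ^\<^sub>m m \<in> carrier_mat n n" for m using X by auto
  have "(\<forall>l<i. (X ^\<^sub>m m) $$ (i, l) = 0) \<and> (X ^\<^sub>m m) $$ (i, i) \<noteq> 0" for m
  proof (induction m)
    case 0
    then show ?case using X i by auto
  next
    case (Suc m)
    have eq: "(X ^\<^sub>m Suc m) $$ (i, l) = (X ^\<^sub>m m) $$ (i, i) * X $$ (i, l)" if l: "l \<le> i" for l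
    proof -
      have "(X ^\<^sub>m Suc m) $$ (i, l) = (\<Sum>r<n. (X ^\<^sub>m m) $$ (i, r) * X $$ (r, l))"
        using index_mat_mult_sum[OF P X i(1), of l] l i by simp
      also have "\<dots> = (\<Sum>r\<in>{i}. (X ^\<^sub>m m) $$ (i, r) * X $$ (r, l))"
      proof (rule sum.mono_neutral_right)
        show "\<forall>r\<in>{..<n} - {i}. (X ^\<^sub>m m) $$ (i, r) * X $$ (r, l) = 0"
        proof
          fix r assume r: "r \<in> {..<n} - {i}"
          then show "(X ^\<^sub>m m) $$ (i, r) * X $$ (r, l) = 0"
            using Suc.IH ut[of r l] l by (cases "r < i") auto
        qed
      qed (use i in auto)
      finally show ?thesis by simp
    qed
    show ?case
    proof (intro conjI allI impI)
      fix l assume "l < i"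
      then show "(X ^\<^sub>m Suc m) $$ (i, l) = 0" using eq[of l] ut[OF i(1)] by simp
    next
      show "(X ^\<^sub>m Suc m) $$ (i, i) \<noteq> 0" using eq[of i] i Suc.IH by simp
    qed
  qed
  from this[of m] show ?thesis using i by auto
qed

definition elem_mat :: "nat \<Rightarrow> nat \<Rightarrow> nat \<Rightarrow> 'a::field mat" where
  "elem_mat n i j = mat n n (\<lambda>(r, c). if r = i \<and> c = j then 1 else 0)"

lemma elem_mat_carrier: "elem_mat n i j \<in> carrier_mat n n"
  by (simp add: elem_mat_def)

lemma elem_mat_bracket:
  assumes "(X::'a::field mat) \<in> carrier_mat n n" "i < n" "j < n" "r < n" "c < n"
  shows "(elem_mat n i j * X - X * elem_mat n i j) $$ (r, c) =
     (if r = i then X $$ (j, c) else 0) - (if c = j then X $$ (r, i) else 0)"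
proof -
  have "(elem_mat n i j * X) $$ (r, c) = (\<Sum>l<n. if l = j then (if r = i then X $$ (j, c) else 0) else 0)"
    unfolding index_mat_mult_sum[OF elem_mat_carrier assms(1,4,5)]
    by (rule sum.cong) (use assms in \<open>auto simp: elem_mat_def\<close>)
  moreover have "(X * elem_mat n i j) $$ (r, c) = (\<Sum>l<n. if l = i then (if c = j then X $$ (r, i) else 0) else 0)"
    unfolding index_mat_mult_sum[OF assms(1) elem_mat_carrier assms(4,5)]
    by (rule sum.cong) (use assms in \<open>auto simp: elem_mat_def\<close>)
  moreover have "(elem_mat n i j * X - X * elem_mat n i j) $$ (r, c) =
      (elem_mat n i j * X) $$ (r, c) - (X * elem_mat n i j) $$ (r, c)"
    using assms by (intro index_minus_mat) (auto simp: elem_mat_def)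
  ultimately show ?thesis
    using assms by simp
qed

lemma parabolic_nilradical_nil_ideal:
  "nil_lie_ideal (sum_list lam) (standard_parabolic lam) (parabolic_nilradical lam)"
proof -
  let ?n = "sum_list lam" and ?b = "block_index lam"
  let ?P = "standard_parabolic lam" and ?U = "parabolic_nilradical lam"
  have br: "Y * X - X * Y \<in> ?U" if Y: "Y \<in> ?P" and X: "X \<in> ?U" for X Y :: "'a mat"
  proof -
    have c: "X \<in> carrier_mat ?n ?n" "Y \<in> carrier_mat ?n ?n"
      using X Y by (auto simp: parabolic_nilradical_def standard_parabolic_def)
    have "(Y * X - X * Y) $$ (i, j) = 0" if ij: "i < ?n" "j < ?n" "\<not> ?b i < ?b j" for i j
    proof -
      have "Y $$ (i, l) * X $$ (l, j) = 0" "X $$ (i, l) * Y $$ (l, j) = 0" if l: "l < ?n" for l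
      proof -
        have XU: "X $$ (r, c) = 0" if "r < ?n" "c < ?n" "\<not> ?b r < ?b c" for r c
          using X that by (auto simp: parabolic_nilradical_def)
        have YP: "Y $$ (r, c) = 0" if "r < ?n" "c < ?n" "\<not> ?b r \<le> ?b c" for r c
          using Y that by (auto simp: standard_parabolic_def)
        show "Y $$ (i, l) * X $$ (l, j) = 0"
          using YP[OF ij(1) l] XU[OF l ij(2)] ij(3) by (cases "?b i \<le> ?b l") auto
        show "X $$ (i, l) * Y $$ (l, j) = 0"
          using XU[OF ij(1) l] YP[OF l ij(2)] ij(3) by (cases "?b i < ?b l") auto
      qed
      then have "(Y * X) $$ (i, j) = 0" "(X * Y) $$ (i, j) = 0"
        unfolding index_mat_mult_sum[OF c(2,1) ij(1,2)] index_mat_mult_sum[OF c ij(1,2)]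
        by (auto intro!: sum.neutral)
      moreover have "(Y * X - X * Y) $$ (i, j) = (Y * X) $$ (i, j) - (X * Y) $$ (i, j)"
        using c ij by (intro index_minus_mat) auto
      ultimately show ?thesis by simp
    qed
    then show ?thesis using c by (auto simp: parabolic_nilradical_def)
  qed
  have nil: "\<exists>m. X ^\<^sub>m m = 0\<^sub>m ?n ?n" if X: "X \<in> ?U" for X :: "'a mat"
  proof (rule exI, rule strictly_upper_nilpotent)
    show "X \<in> carrier_mat ?n ?n" using X by (auto simp: parabolic_nilradical_def)
    fix i j assume ij: "i < ?n" "j < ?n" "j \<le> i"
    then show "X $$ (i, j) = 0"
      using block_index_mono[of j i lam] X by (auto simp: parabolic_nilradical_def)
  qed
  show ?thesis
    unfolding nil_lie_ideal_def using br nil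
    by (auto simp: parabolic_nilradical_def standard_parabolic_def)
qed

lemma parabolic_nilradical_largest:
  assumes I: "nil_lie_ideal (sum_list lam) (standard_parabolic lam) (I :: 'a::field mat set)"
  shows "I \<subseteq> parabolic_nilradical lam"
proof
  let ?n = "sum_list lam" and ?b = "block_index lam"
  let ?br = "\<lambda>i j X. elem_mat ?n i j * X - X * elem_mat ?n i j"
  have Icar: "X \<in> carrier_mat ?n ?n" and Ipar: "\<And>i j. i < ?n \<Longrightarrow> j < ?n \<Longrightarrow> ?b j < ?b i \<Longrightarrow> X $$ (i, j) = 0"
    and Inil: "\<exists>m. X ^\<^sub>m m = 0\<^sub>m ?n ?n" if "X \<in> I" for X
    using I that by (fastforce simp: nil_lie_ideal_def standard_parabolic_def)+
  have brI: "?br i j X \<in> I" if "X \<in> I" "i < ?n" "j < ?n" "?b i \<le> ?b j" for X i j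
  proof -
    have "elem_mat ?n i j \<in> standard_parabolic lam"
      using that by (auto simp: standard_parabolic_def elem_mat_def)
    then show ?thesis using I that unfolding nil_lie_ideal_def by blast
  qed
  have off: "X $$ (i, j) = 0" if X: "X \<in> I" and ij: "i < ?n" "j < ?n" "i \<noteq> j" "?b i = ?b j" for X i j
  proof (rule ccontr)
    assume nz: "X $$ (i, j) \<noteq> 0"
    define Z where "Z = ?br j j (?br i i X)"
    have "?br i i X \<in> I" using brI X ij by simp
    then have ZI: "Z \<in> I" and c1: "?br i i X \<in> carrier_mat ?n ?n"
      unfolding Z_def using brI ij Icar by auto
    note Xc = Icar[OF X] and Zc = Icar[OF ZI]
    have Zent: "Z $$ (r, c) = (if r = i \<and> c = j then - X $$ (i, j) else if r = j \<and> c = i then - X $$ (j, i) else 0)"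
      if rc: "r < ?n" "c < ?n" for r c
      unfolding Z_def elem_mat_bracket[OF c1 ij(2,2) rc]
      using elem_mat_bracket[OF Xc ij(1,1) ij(2) rc(2)] elem_mat_bracket[OF Xc ij(1,1) rc(1) ij(2)] ij
      by auto
    have ji: "X $$ (j, i) = 0"
    proof (rule ccontr)
      assume "X $$ (j, i) \<noteq> 0"
      then have "Z ^\<^sub>m m \<noteq> 0\<^sub>m ?n ?n" for m
        by (intro two_step_row_not_nilpotent[OF Zc ij(1,2,3)]) (use Zent ij nz in auto)
      then show False using Inil[OF ZI] by blast
    qed
    define D where "D = ?br j i Z"
    have DI: "D \<in> I" unfolding D_def using brI ZI ij by simp
    have Dent: "D $$ (r, c) = (if r = j \<and> c = j then - X $$ (i, j) else if r = i \<and> c = i then X $$ (i, j) else 0)"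
      if rc: "r < ?n" "c < ?n" for r c
      unfolding D_def elem_mat_bracket[OF Zc ij(2,1) rc]
      using Zent[OF ij(1) rc(2)] Zent[OF rc(1) ij(2)] ij ji by auto
    have "D ^\<^sub>m m \<noteq> 0\<^sub>m ?n ?n" for m
      by (rule upper_triangular_not_nilpotent[OF Icar[OF DI] _ ij(1)]) (use Dent ij nz in auto)
    then show False using Inil[OF DI] by blast
  qed
  fix X assume X: "X \<in> I"
  have ut: "X $$ (i, j) = 0" if "i < ?n" "j < i" for i j
    using block_index_mono[of j i lam] Ipar[OF X, of i j] off[OF X, of i j] that
    by (cases "?b j = ?b i") auto
  have diag: "X $$ (i, i) = 0" if "i < ?n" for i
  proof (rule ccontr)
    assume nz: "X $$ (i, i) \<noteq> 0"
    then have "X ^\<^sub>m m \<noteq> 0\<^sub>m ?n ?n" for m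
      by (intro upper_triangular_not_nilpotent[OF Icar[OF X] _ that nz] ut)
    then show False using Inil[OF X] by blast
  qed
  have "X $$ (i, j) = 0" if "i < ?n" "j < ?n" "\<not> ?b i < ?b j" for i j
    using off[OF X, of i j] Ipar[OF X, of i j] diag that by (cases "i = j"; cases "?b i = ?b j") auto
  then show "X \<in> parabolic_nilradical lam"
    using Icar[OF X] by (auto simp: parabolic_nilradical_def)
qed

end

theory Submission
  imports Defs "Jordan_Normal_Form.Jordan_Normal_Form_Existence" "HOL-Library.Cardinality"
begin

text \<open>A nilpotent matrix \<open>X\<close> has Jordan type \<open>(k + 1, 1, \<dots>, 1)\<close> exactly if it has rank \<open>k\<close> and
  \<open>X\<^sup>k \<noteq> 0\<close>. Remove the last block of \<open>\<lambda>\<close>: a matrix in the nilradical is \<open>Y = [[X, B], [0, 0]]\<close>, whose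
  range is \<open>W = im X + im B\<close>, and \<open>Y\<^sup>k \<noteq> 0\<close> says that \<open>W\<close> is not killed by the power \<open>k - 1\<close> of \<open>X\<close>. Hence
  either \<open>X\<close> already has type \<open>k\<close> and the columns of \<open>B\<close> lie in \<open>im X\<close>, or \<open>X\<close> has type \<open>k - 1\<close> and \<open>B\<close>
  enlarges \<open>im X\<close> by one dimension not contained in the kernel of that power, which is a hyperplane (and is
  zero if \<open>k = 1\<close>). This gives a recursion on the last block which is also satisfied by the sum over
  subsets, by splitting according to whether the last index belongs to the subset.\<close>

section \<open>Subspaces over a finite field\<close>

text \<open>Write q for the size of the field. Subspaces are measured by their number of elements,
  so bases never enter: a proper inclusion gains a factor of at least q. Rank k and X^k nonzero
  single out the hook because the rank is the sum of m - 1 over the block sizes m, and a block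
  larger than k already contributes k. No other X occurs in the recursion: if B enlarges the range
  to dimension k, then X has rank at most k - 1, and since X^(k-1) does not kill W it is nonzero,
  which forces rank at least k - 1. Its kernel is a hyperplane because the ranks of the powers of a
  nilpotent matrix drop strictly until they reach zero, which leaves rank one for X^(k-1). The
  subset A records the blocks at which the rank grows. At a later such block there are q^n - q^(n-1)
  vectors off the hyperplane, with n the total size of the blocks before it; this is q - 1 times a
  power of q. At the first one, where the matrix stops being zero, there are q^n - 1 nonzero
  vectors. This is the origin of the extra bracket of lambda_1 + ... + lambda_(j-1).\<close>

lemma finite_card_carrier_vec:
  "finite (carrier_vec n :: 'a::finite vec set)"
  "card (carrier_vec n :: 'a::finite vec set) = CARD('a) ^ n"
proof -
  have eq: "carrier_vec n = vec_of_list ` {xs :: 'a list. set xs \<subseteq> UNIV \<and> length xs = n}"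
  proof (intro equalityI subsetI)
    fix v :: "'a vec" assume "v \<in> carrier_vec n"
    then show "v \<in> vec_of_list ` {xs. set xs \<subseteq> UNIV \<and> length xs = n}"
      by (intro image_eqI[of _ _ "list_of_vec v"]) (auto simp: vec_list)
  qed (auto intro: carrier_vecI)
  have inj: "inj_on vec_of_list {xs :: 'a list. set xs \<subseteq> UNIV \<and> length xs = n}"
    by (intro inj_onI) (metis list_vec)
  show "finite (carrier_vec n :: 'a vec set)"
    unfolding eq by (intro finite_imageI finite_lists_length_eq) simp
  show "card (carrier_vec n :: 'a vec set) = CARD('a) ^ n"
    unfolding eq card_image[OF inj] by (rule card_lists_length_eq) simp
qed

lemma field_card_ge_2: "2 \<le> CARD('a::{field,finite})"
proof -
  have "card {0, 1 :: 'a} \<le> CARD('a)" by (rule card_mono) auto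
  then show ?thesis by simp
qed

definition vec_subspace :: "nat \<Rightarrow> 'a::field vec set \<Rightarrow> bool" where
  "vec_subspace n S \<longleftrightarrow> S \<subseteq> carrier_vec n \<and> 0\<^sub>v n \<in> S \<and>
     (\<forall>v\<in>S. \<forall>w\<in>S. v + w \<in> S) \<and> (\<forall>c. \<forall>v\<in>S. c \<cdot>\<^sub>v v \<in> S)"

text \<open>The span of a subspace and one further vector. Adjoining vectors one at a time fits the
  later counting of matrices column by column.\<close>

definition adjoin_vec :: "'a::field vec set \<Rightarrow> 'a vec \<Rightarrow> 'a vec set" where
  "adjoin_vec S v = (\<lambda>(c, s). s + c \<cdot>\<^sub>v v) ` (UNIV \<times> S)"

lemma adjoin_vecI: "s \<in> S \<Longrightarrow> s + c \<cdot>\<^sub>v v \<in> adjoin_vec S v"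
  by (auto simp: adjoin_vec_def)

lemma adjoin_vecE:
  assumes "x \<in> adjoin_vec S v"
  obtains c s where "s \<in> S" "x = s + c \<cdot>\<^sub>v v"
  using assms by (auto simp: adjoin_vec_def)

lemma vec_subspaceD:
  assumes "vec_subspace n S"
  shows "S \<subseteq> carrier_vec n" "0\<^sub>v n \<in> S" "\<And>v w. v \<in> S \<Longrightarrow> w \<in> S \<Longrightarrow> v + w \<in> S"
    "\<And>c v. v \<in> S \<Longrightarrow> c \<cdot>\<^sub>v v \<in> S" "\<And>v w. v \<in> S \<Longrightarrow> w \<in> S \<Longrightarrow> v - w \<in> S"
proof -
  show 1: "S \<subseteq> carrier_vec n" "0\<^sub>v n \<in> S" "\<And>v w. v \<in> S \<Longrightarrow> w \<in> S \<Longrightarrow> v + w \<in> S"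
    and 2: "\<And>c v. v \<in> S \<Longrightarrow> c \<cdot>\<^sub>v v \<in> S" using assms by (auto simp: vec_subspace_def)
  fix v w assume vw: "v \<in> S" "w \<in> S"
  have "v - w = v + (-1) \<cdot>\<^sub>v w" using vw 1(1) by (intro eq_vecI) auto
  then show "v - w \<in> S" using 1(3)[OF vw(1) 2[OF vw(2), of "-1"]] by simp
qed

lemma vec_subspace_finite:
  "vec_subspace n (S :: 'a::{field,finite} vec set) \<Longrightarrow> finite S"
  using finite_card_carrier_vec(1) finite_subset vec_subspaceD(1) by blast

lemma vec_subspace_card_pos:
  "vec_subspace n (S :: 'a::{field,finite} vec set) \<Longrightarrow> 0 < card S"
  using vec_subspace_finite vec_subspaceD(2) by (metis card_gt_0_iff empty_iff)

lemma vec_subspace_carrier: "vec_subspace n (carrier_vec n)"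
  by (auto simp: vec_subspace_def)

lemma subset_adjoin_vec:
  assumes "vec_subspace n S" "v \<in> carrier_vec n"
  shows "S \<subseteq> adjoin_vec S v" "v \<in> adjoin_vec S v"
proof -
  show "S \<subseteq> adjoin_vec S v"
  proof
    fix s assume s: "s \<in> S"
    then have "s + 0 \<cdot>\<^sub>v v = s" using vec_subspaceD(1)[OF assms(1)] assms(2) by (intro eq_vecI) auto
    then show "s \<in> adjoin_vec S v" using adjoin_vecI[OF s, of 0 v] by simp
  qed
  have "0\<^sub>v n + 1 \<cdot>\<^sub>v v = v" using assms(2) by simp
  then show "v \<in> adjoin_vec S v"
    using adjoin_vecI[OF vec_subspaceD(2)[OF assms(1)], of 1 v] by simp
qed

lemma vec_subspace_adjoin:
  assumes S: "vec_subspace n S" and v: "v \<in> carrier_vec n"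
  shows "vec_subspace n (adjoin_vec S v)"
  unfolding vec_subspace_def
proof (intro conjI ballI allI)
  note SD = vec_subspaceD[OF S]
  show "adjoin_vec S v \<subseteq> carrier_vec n" using SD(1) v by (auto simp: adjoin_vec_def)
  show "0\<^sub>v n \<in> adjoin_vec S v" using subset_adjoin_vec[OF S v] SD(2) by blast
  fix x assume "x \<in> adjoin_vec S v"
  then obtain s c where x: "s \<in> S" "x = s + c \<cdot>\<^sub>v v" by (rule adjoin_vecE)
  {
    fix y assume "y \<in> adjoin_vec S v"
    then obtain t d where y: "t \<in> S" "y = t + d \<cdot>\<^sub>v v" by (rule adjoin_vecE)
    have "x + y = (s + t) + (c + d) \<cdot>\<^sub>v v"
      unfolding x(2) y(2) using x(1) y(1) SD(1) v by (intro eq_vecI) (auto simp: algebra_simps)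
    then show "x + y \<in> adjoin_vec S v" using adjoin_vecI SD(3)[OF x(1) y(1)] by metis
  next
    fix a
    have "a \<cdot>\<^sub>v x = a \<cdot>\<^sub>v s + (a * c) \<cdot>\<^sub>v v"
      unfolding x(2) using x(1) SD(1) v by (intro eq_vecI) (auto simp: algebra_simps)
    then show "a \<cdot>\<^sub>v x \<in> adjoin_vec S v" using adjoin_vecI SD(4)[OF x(1)] by metis
  }
qed

lemma adjoin_vec_subset:
  assumes T: "vec_subspace n T" and "S \<subseteq> T" "v \<in> T"
  shows "adjoin_vec S v \<subseteq> T"
  using assms vec_subspaceD(3,4)[OF T] by (auto simp: adjoin_vec_def)

lemma adjoin_vec_absorb:
  assumes "vec_subspace n S" "v \<in> S"
  shows "adjoin_vec S v = S"
  using adjoin_vec_subset[OF assms(1) order_refl assms(2)] subset_adjoin_vec[OF assms(1)]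
    vec_subspaceD(1)[OF assms(1)] assms(2) by blast

text \<open>The representation s + c v is unique: two different coefficients would exhibit v as a
  multiple of a difference of elements of \<open>S\<close>.\<close>

lemma card_adjoin_vec:
  assumes S: "vec_subspace n (S :: 'a::{field,finite} vec set)" and v: "v \<in> carrier_vec n" "v \<notin> S"
  shows "card (adjoin_vec S v) = CARD('a) * card S"
proof -
  note SD = vec_subspaceD[OF S]
  have "inj_on (\<lambda>(c, s). s + c \<cdot>\<^sub>v v) (UNIV \<times> S)"
  proof (rule inj_onI, clarify)
    fix c s d t assume st: "s \<in> S" "t \<in> S" and eq: "s + c \<cdot>\<^sub>v v = t + d \<cdot>\<^sub>v v"
    have car: "s \<in> carrier_vec n" "t \<in> carrier_vec n" using st SD(1) by auto
    have ent: "s $ i + c * v $ i = t $ i + d * v $ i" if "i < n" for i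
      using arg_cong[OF eq, of "\<lambda>x. x $ i"] that car v by simp
    have "c = d"
    proof (rule ccontr)
      assume cd: "c \<noteq> d"
      have "v = inverse (c - d) \<cdot>\<^sub>v (t - s)"
      proof (rule eq_vecI)
        fix i assume "i < dim_vec (inverse (c - d) \<cdot>\<^sub>v (t - s))"
        then have i: "i < n" using car by simp
        have "(c - d) * v $ i = t $ i - s $ i" using ent[OF i] by (simp add: algebra_simps)
        then show "v $ i = (inverse (c - d) \<cdot>\<^sub>v (t - s)) $ i"
          using cd i car by (simp add: field_simps)
      qed (use v car in auto)
      then show False using SD(4)[OF SD(5)[OF st(2,1)]] v(2) by metis
    qed
    moreover have "s = t"
      using ent car \<open>c = d\<close> by (intro eq_vecI) auto
    ultimately show "c = d \<and> s = t" by simp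
  qed
  then show ?thesis unfolding adjoin_vec_def by (simp add: card_image card_cartesian_product)
qed

text \<open>Plays the part of "a larger subspace has larger dimension": the bigger space contains
  \<open>adjoin_vec S v\<close> for any of its vectors outside \<open>S\<close>.\<close>

lemma card_psubspace:
  assumes S: "vec_subspace n (S :: 'a::{field,finite} vec set)" and T: "vec_subspace n T" and "S \<subset> T"
  shows "CARD('a) * card S \<le> card T"
proof -
  obtain v where v: "v \<in> T" "v \<notin> S" using assms(3) by blast
  then have vn: "v \<in> carrier_vec n" using vec_subspaceD(1)[OF T] by blast
  have "card (adjoin_vec S v) \<le> card T"
    using adjoin_vec_subset[OF T _ v(1), of S] assms(3) vec_subspace_finite[OF T]
    by (intro card_mono) auto
  then show ?thesis using card_adjoin_vec[OF S vn v(2)] by simp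
qed

section \<open>Ranges, kernels and powers of matrices\<close>

definition mat_range :: "'a::field mat \<Rightarrow> 'a vec set" where
  "mat_range A = (*\<^sub>v) A ` carrier_vec (dim_col A)"

lemma vec_subspace_image:
  assumes A: "A \<in> carrier_mat m n" and S: "vec_subspace n S"
  shows "vec_subspace m ((*\<^sub>v) A ` S)"
proof -
  note SD = vec_subspaceD[OF S]
  have "A *\<^sub>v v + A *\<^sub>v w \<in> (*\<^sub>v) A ` S" if "v \<in> S" "w \<in> S" for v w
    using mult_add_distrib_mat_vec[OF A, of v w] SD(1,3) that by (metis image_eqI subsetD)
  moreover have "c \<cdot>\<^sub>v (A *\<^sub>v v) \<in> (*\<^sub>v) A ` S" if "v \<in> S" for v c
    using mult_mat_vec[OF A, of v c] SD(1,4) that by (metis image_eqI subsetD)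
  moreover have "0\<^sub>v m \<in> (*\<^sub>v) A ` S"
    using SD(2) A by (intro image_eqI[of _ _ "0\<^sub>v n"]) auto
  ultimately show ?thesis using A SD(1) by (auto simp: vec_subspace_def)
qed

lemma vec_subspace_mat_range:
  "A \<in> carrier_mat m n \<Longrightarrow> vec_subspace m (mat_range A)"
  unfolding mat_range_def using vec_subspace_image[OF _ vec_subspace_carrier] by auto

definition mat_null :: "'a::field mat \<Rightarrow> 'a vec set" where
  "mat_null A = {v \<in> carrier_vec (dim_col A). A *\<^sub>v v = 0\<^sub>v (dim_row A)}"

lemma vec_subspace_mat_null:
  "A \<in> carrier_mat m n \<Longrightarrow> vec_subspace n (mat_null A)"
  unfolding vec_subspace_def mat_null_def
  by (auto simp: mult_add_distrib_mat_vec[of A m n] mult_mat_vec[of A m n])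

text \<open>Every nonempty fibre of the linear map is a translate of its kernel, so the domain
  splits into equally large fibres over the range.\<close>

lemma rank_nullity_card:
  assumes A: "(A :: 'a::{field,finite} mat) \<in> carrier_mat m n"
  shows "card (mat_range A) * card (mat_null A) = CARD('a) ^ n"
proof -
  note N = vec_subspaceD[OF vec_subspace_mat_null[OF A]]
  have cA: "dim_col A = n" "dim_row A = m" using A by auto
  have fib: "card {v \<in> carrier_vec n. A *\<^sub>v v = y} = card (mat_null A)" if y: "y \<in> mat_range A" for y
  proof -
    obtain u where u: "u \<in> carrier_vec n" "y = A *\<^sub>v u" using y by (auto simp: mat_range_def cA)
    have "bij_betw (\<lambda>w. u + w) (mat_null A) {v \<in> carrier_vec n. A *\<^sub>v v = y}"
    proof (rule bij_betw_byWitness[where f' = "\<lambda>v. v - u"])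
      show "\<forall>w\<in>mat_null A. u + w - u = w" using N(1) u by (auto intro!: eq_vecI)
      show "\<forall>v\<in>{v \<in> carrier_vec n. A *\<^sub>v v = y}. u + (v - u) = v" using u by (auto intro!: eq_vecI)
      show "(\<lambda>w. u + w) ` mat_null A \<subseteq> {v \<in> carrier_vec n. A *\<^sub>v v = y}"
        using u A by (auto simp: mat_null_def mult_add_distrib_mat_vec[OF A])
      show "(\<lambda>v. v - u) ` {v \<in> carrier_vec n. A *\<^sub>v v = y} \<subseteq> mat_null A"
        using u A by (auto simp: mat_null_def mult_minus_distrib_mat_vec[OF A])
    qed
    then show ?thesis by (simp add: bij_betw_same_card)
  qed
  have "CARD('a) ^ n = card (\<Union>y\<in>mat_range A. {v \<in> carrier_vec n. A *\<^sub>v v = y})"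
    unfolding finite_card_carrier_vec(2)[symmetric]
    by (rule arg_cong[of _ _ card]) (auto simp: mat_range_def cA)
  also have "\<dots> = (\<Sum>y\<in>mat_range A. card {v \<in> carrier_vec n. A *\<^sub>v v = y})"
    using finite_card_carrier_vec(1)[of n] vec_subspace_finite[OF vec_subspace_mat_range[OF A]]
    by (intro card_UN_disjoint) (auto intro: finite_subset)
  also have "\<dots> = card (mat_range A) * card (mat_null A)" using fib by simp
  finally show ?thesis by simp
qed

lemma eq_mat_vecI:
  assumes A: "A \<in> carrier_mat m n" and B: "B \<in> carrier_mat m n"
    and eq: "\<And>v. v \<in> carrier_vec n \<Longrightarrow> A *\<^sub>v v = B *\<^sub>v (v :: 'a::field vec)"
  shows "A = B"
proof (rule eq_matI)
  fix i j assume ij: "i < dim_row B" "j < dim_col B"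
  have "(A *\<^sub>v unit_vec n j) $ i = (B *\<^sub>v unit_vec n j) $ i" using eq by simp
  then show "A $$ (i, j) = B $$ (i, j)" using ij A B by simp
qed (use A B in auto)

lemma zero_mat_mult_vec: "v \<in> carrier_vec n \<Longrightarrow> 0\<^sub>m m n *\<^sub>v v = 0\<^sub>v m"
  by (intro eq_vecI) auto

lemma mat_eq_0_iff:
  assumes A: "(A :: 'a::field mat) \<in> carrier_mat m n"
  shows "A = 0\<^sub>m m n \<longleftrightarrow> (\<forall>v \<in> carrier_vec n. A *\<^sub>v v = 0\<^sub>v m)"
  using eq_mat_vecI[OF A, of "0\<^sub>m m n"] by (auto simp: zero_mat_mult_vec)

lemma mat_eq_0_iff_card_range:
  assumes A: "(A :: 'a::{field,finite} mat) \<in> carrier_mat m n"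
  shows "A = 0\<^sub>m m n \<longleftrightarrow> card (mat_range A) = 1"
proof
  assume "card (mat_range A) = 1"
  then have "mat_range A = {0\<^sub>v m}"
    using vec_subspaceD(2)[OF vec_subspace_mat_range[OF A]] by (metis card_1_singletonE singletonD)
  then show "A = 0\<^sub>m m n" unfolding mat_eq_0_iff[OF A] using A by (auto simp: mat_range_def)
next
  assume "A = 0\<^sub>m m n"
  moreover have "\<exists>x. x \<in> (carrier_vec n :: 'a vec set)" using zero_carrier_vec by blast
  ultimately have "mat_range A = {0\<^sub>v m}"
    by (auto simp: mat_range_def image_iff zero_mat_mult_vec)
  then show "card (mat_range A) = 1" by simp
qed

lemma card_field_le_card_range:
  assumes A: "(A :: 'a::{field,finite} mat) \<in> carrier_mat m n" and "A \<noteq> 0\<^sub>m m n"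
  shows "CARD('a) \<le> card (mat_range A)"
proof -
  have "vec_subspace m {0\<^sub>v m :: 'a vec}" by (auto simp: vec_subspace_def)
  moreover have "{0\<^sub>v m} \<subset> mat_range A"
    using assms vec_subspaceD(2)[OF vec_subspace_mat_range[OF A]] mat_eq_0_iff_card_range[OF A]
    by (metis One_nat_def card.empty card_Suc_eq empty_iff insert_subset order_le_less subsetI)
  ultimately have "CARD('a) * card {0\<^sub>v m :: 'a vec} \<le> card (mat_range A)"
    by (rule card_psubspace[OF _ vec_subspace_mat_range[OF A]])
  then show ?thesis by simp
qed

lemma mat_range_mult:
  assumes "A \<in> carrier_mat l m" "B \<in> carrier_mat m n"
  shows "mat_range (A * B) = (*\<^sub>v) A ` mat_range B"
  using assms by (auto simp: mat_range_def image_image assoc_mult_mat_vec[OF assms])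

lemma pow_mat_Suc_left:
  assumes X: "X \<in> carrier_mat n n"
  shows "X ^\<^sub>m Suc i = X * X ^\<^sub>m i"
proof (induction i)
  case (Suc i)
  have "X ^\<^sub>m Suc (Suc i) = X * X ^\<^sub>m i * X" using Suc by simp
  also have "\<dots> = X * X ^\<^sub>m Suc i" using X by (simp add: assoc_mult_mat[of _ n n _ n _ n])
  finally show ?case .
qed (use X in auto)

lemma pow_mat_add:
  assumes X: "X \<in> carrier_mat n n"
  shows "X ^\<^sub>m (i + j) = X ^\<^sub>m i * X ^\<^sub>m j"
proof (induction j)
  case (Suc j)
  have "X ^\<^sub>m (i + Suc j) = X ^\<^sub>m i * X ^\<^sub>m j * X" using Suc by simp
  also have "\<dots> = X ^\<^sub>m i * X ^\<^sub>m Suc j" using X by (simp add: assoc_mult_mat[of _ n n _ n _ n])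
  finally show ?case .
qed (use X in auto)

lemma mat_range_pow_Suc:
  assumes X: "X \<in> carrier_mat n n"
  shows "mat_range (X ^\<^sub>m Suc i) = (*\<^sub>v) X ` mat_range (X ^\<^sub>m i)"
    "mat_range (X ^\<^sub>m Suc i) \<subseteq> mat_range (X ^\<^sub>m i)"
proof -
  show "mat_range (X ^\<^sub>m Suc i) = (*\<^sub>v) X ` mat_range (X ^\<^sub>m i)"
    unfolding pow_mat_Suc_left[OF X] using X by (intro mat_range_mult) auto
  have "mat_range (X ^\<^sub>m i * X) = (*\<^sub>v) (X ^\<^sub>m i) ` mat_range X"
    using X by (intro mat_range_mult) auto
  moreover have "mat_range X \<subseteq> carrier_vec n" using vec_subspace_mat_range[OF X] vec_subspaceD(1) by blast
  ultimately show "mat_range (X ^\<^sub>m Suc i) \<subseteq> mat_range (X ^\<^sub>m i)"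
    using X by (auto simp: mat_range_def)
qed

text \<open>If two consecutive powers had the same range, all later powers would share it, and
  nilpotency would make it zero.\<close>

lemma mat_range_pow_strict:
  assumes X: "X \<in> carrier_mat n n" and nil: "X ^\<^sub>m N = 0\<^sub>m n n" and nz: "X ^\<^sub>m i \<noteq> 0\<^sub>m n n"
  shows "mat_range (X ^\<^sub>m Suc i) \<subset> mat_range (X ^\<^sub>m i)"
proof (rule ccontr)
  assume "\<not> ?thesis"
  then have eq: "mat_range (X ^\<^sub>m Suc i) = mat_range (X ^\<^sub>m i)" using mat_range_pow_Suc(2)[OF X] by blast
  have "mat_range (X ^\<^sub>m (i + j)) = mat_range (X ^\<^sub>m i)" for j
  proof (induction j)
    case (Suc j)
    have "mat_range (X ^\<^sub>m (i + Suc j)) = mat_range (X ^\<^sub>m Suc i)"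
      using mat_range_pow_Suc(1)[OF X] Suc by (metis add_Suc_right)
    then show ?case using eq by simp
  qed simp
  \<comment> \<open>The exponent \<open>N + i\<close> is beyond stabilisation and beyond the
    nilpotency index at once.\<close>
  then have *: "mat_range (X ^\<^sub>m (N + i)) = mat_range (X ^\<^sub>m i)" by (metis add.commute)
  have "X ^\<^sub>m (N + i) = X ^\<^sub>m N * X ^\<^sub>m i" using X by (rule pow_mat_add)
  then have "X ^\<^sub>m (N + i) = 0\<^sub>m n n" using X nil by simp
  moreover have "mat_range (0\<^sub>m n n :: 'a mat) \<subseteq> {0\<^sub>v n}"
    by (auto simp: mat_range_def zero_mat_mult_vec)
  ultimately have "mat_range (X ^\<^sub>m i) \<subseteq> {0\<^sub>v n}" using * by simp
  then have "X ^\<^sub>m i = 0\<^sub>m n n"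
    using X by (subst mat_eq_0_iff[of _ n n]) (auto simp: mat_range_def split: if_splits)
  with nz show False by simp
qed

lemma pow_mat_zero_mono:
  assumes X: "X \<in> carrier_mat n n" and "X ^\<^sub>m i = 0\<^sub>m n n" "i \<le> j"
  shows "X ^\<^sub>m j = 0\<^sub>m n n"
proof -
  have "X ^\<^sub>m j = X ^\<^sub>m i * X ^\<^sub>m (j - i)" using pow_mat_add[OF X, of i "j - i"] assms(3) by simp
  then show ?thesis using assms(2) X by simp
qed

text \<open>Each of the \<open>j\<close> further multiplications by \<open>X\<close> takes a nonzero
  power to one with strictly smaller range, so each costs a factor of at least q. With i = 1 this
  bounds the rank of \<open>X\<close> from below and the rank of its powers from above.\<close>

lemma card_mat_range_pow:
  assumes X: "(X :: 'a::{field,finite} mat) \<in> carrier_mat n n" and nil: "X ^\<^sub>m N = 0\<^sub>m n n"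
    and nz: "X ^\<^sub>m (i + j) \<noteq> 0\<^sub>m n n"
  shows "CARD('a) ^ j * card (mat_range (X ^\<^sub>m (i + j))) \<le> card (mat_range (X ^\<^sub>m i))"
  using nz
proof (induction j)
  case (Suc j)
  have nz': "X ^\<^sub>m (i + j) \<noteq> 0\<^sub>m n n" using Suc.prems pow_mat_zero_mono[OF X, of "i + j" "i + Suc j"] by auto
  have "CARD('a) * card (mat_range (X ^\<^sub>m Suc (i + j))) \<le> card (mat_range (X ^\<^sub>m (i + j)))"
    using X by (intro card_psubspace[of n] vec_subspace_mat_range mat_range_pow_strict[OF X nil nz']) auto
  then have "CARD('a) ^ j * (CARD('a) * card (mat_range (X ^\<^sub>m Suc (i + j))))
      \<le> CARD('a) ^ j * card (mat_range (X ^\<^sub>m (i + j)))" by (rule mult_le_mono2)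
  also have "\<dots> \<le> card (mat_range (X ^\<^sub>m i))" by (rule Suc.IH[OF nz'])
  finally show ?case by (simp add: mult_ac)
qed simp

section \<open>Spans obtained by adjoining a list of vectors\<close>

lemma foldl_adjoin_vec:
  assumes "vec_subspace n S" "set bs \<subseteq> carrier_vec n"
  shows "vec_subspace n (foldl adjoin_vec S bs)"
    "S \<subseteq> foldl adjoin_vec S bs" "set bs \<subseteq> foldl adjoin_vec S bs"
proof -
  have "vec_subspace n (foldl adjoin_vec S bs) \<and> S \<subseteq> foldl adjoin_vec S bs \<and> set bs \<subseteq> foldl adjoin_vec S bs"
    using assms
  proof (induction bs arbitrary: S)
    case (Cons b bs)
    then have b: "b \<in> carrier_vec n" by simp
    from Cons.IH[OF vec_subspace_adjoin[OF Cons.prems(1) b]] subset_adjoin_vec[OF Cons.prems(1) b] Cons.prems(2)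
    show ?case by auto
  qed simp
  then show "vec_subspace n (foldl adjoin_vec S bs)"
    "S \<subseteq> foldl adjoin_vec S bs" "set bs \<subseteq> foldl adjoin_vec S bs" by auto
qed

lemma foldl_adjoin_vec_subset_iff:
  assumes "vec_subspace n S" "vec_subspace n T" "set bs \<subseteq> carrier_vec n"
  shows "foldl adjoin_vec S bs \<subseteq> T \<longleftrightarrow> S \<subseteq> T \<and> set bs \<subseteq> T"
proof
  assume "S \<subseteq> T \<and> set bs \<subseteq> T"
  with assms(1,3) show "foldl adjoin_vec S bs \<subseteq> T"
  proof (induction bs arbitrary: S)
    case (Cons b bs)
    then show ?case
      using vec_subspace_adjoin[of n S b] adjoin_vec_subset[OF assms(2), of S b] by simp
  qed simp
qed (use foldl_adjoin_vec[OF assms(1,3)] in blast)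

text \<open>The cardinality form of "these vectors add no dimension"; finiteness turns equal size
  into equality of the nested spaces.\<close>

lemma card_foldl_adjoin_vec_eq_iff:
  assumes S: "vec_subspace n (S :: 'a::{field,finite} vec set)" and bs: "set bs \<subseteq> carrier_vec n"
  shows "card (foldl adjoin_vec S bs) = card S \<longleftrightarrow> set bs \<subseteq> S"
proof
  note F = foldl_adjoin_vec[OF assms]
  assume "card (foldl adjoin_vec S bs) = card S"
  then have "S = foldl adjoin_vec S bs"
    using F(2) card_subset_eq[OF vec_subspace_finite[OF F(1)] F(2)] by simp
  then show "set bs \<subseteq> S" using F(3) by simp
next
  assume "set bs \<subseteq> S"
  then have "foldl adjoin_vec S bs = S"
    using foldl_adjoin_vec_subset_iff[OF S S bs] foldl_adjoin_vec(2)[OF assms] by blast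
  then show "card (foldl adjoin_vec S bs) = card S" by simp
qed

lemma card_lists_over:
  assumes "finite A"
  shows "card {bs. length bs = m \<and> set bs \<subseteq> A} = card A ^ m"
  using card_lists_length_eq[OF assms, of m] by (simp add: conj_commute)

text \<open>In such a list the first vector outside \<open>U\<close> must avoid \<open>K\<close>, since otherwise the whole span would lie
  in \<open>K\<close>; the vectors after it are arbitrary in the span reached.\<close>

lemma card_one_step_extensions:
  fixes U K :: "'a::{field,finite} vec set"
  assumes U: "vec_subspace n U" and K: "vec_subspace n K" and UK: "U \<subseteq> K"
  shows "real (card {bs. length bs = m \<and> set bs \<subseteq> carrier_vec n \<and> \<not> set bs \<subseteq> K \<and>
            card (foldl adjoin_vec U bs) = CARD('a) * card U}) * (real (CARD('a) * card U) - real (card U)) =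
         (real (CARD('a) ^ n) - real (card K)) * (real (CARD('a) * card U) ^ m - real (card U) ^ m)"
proof (induction m)
  case 0
  then show ?case by simp
next
  case (Suc m)
  let ?q = "CARD('a)" and ?V = "carrier_vec n :: 'a vec set"
  define G where "G m = {bs. length bs = m \<and> set bs \<subseteq> ?V \<and> \<not> set bs \<subseteq> K \<and>
            card (foldl adjoin_vec U bs) = ?q * card U}" for m
  define L where "L b = {bs. length bs = m \<and> set bs \<subseteq> adjoin_vec U b}" for b
  have fin: "finite U" "finite K" using vec_subspace_finite U K by auto
  have UV: "U \<subseteq> ?V" and KV: "K \<subseteq> ?V" using vec_subspaceD(1) U K by auto
  have eq: "G (Suc m) = (\<lambda>(b, bs). b # bs) ` (U \<times> G m \<union> Sigma (?V - K) L)"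
  proof (intro equalityI subsetI)
    fix xs assume xs: "xs \<in> G (Suc m)"
    then obtain b bs where xsb: "xs = b # bs" by (cases xs) (auto simp: G_def)
    have bV: "b \<in> ?V" and bsV: "set bs \<subseteq> ?V" using xs xsb by (auto simp: G_def)
    have "(b, bs) \<in> U \<times> G m \<union> Sigma (?V - K) L"
    proof (cases "b \<in> U")
      case True
      then show ?thesis using xs UK by (auto simp: xsb G_def adjoin_vec_absorb[OF U])
    next
      case False
      note c = card_adjoin_vec[OF U bV False] and A = vec_subspace_adjoin[OF U bV]
      have bs: "set bs \<subseteq> adjoin_vec U b"
        using xs c card_foldl_adjoin_vec_eq_iff[OF A bsV] by (simp add: xsb G_def)
      have "b \<notin> K"
        using adjoin_vec_subset[OF K UK, of b] bs xs by (auto simp: xsb G_def)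
      then show ?thesis using bV bs xs by (auto simp: xsb G_def L_def)
    qed
    then show "xs \<in> (\<lambda>(b, bs). b # bs) ` (U \<times> G m \<union> Sigma (?V - K) L)" using xsb by force
  next
    fix xs assume "xs \<in> (\<lambda>(b, bs). b # bs) ` (U \<times> G m \<union> Sigma (?V - K) L)"
    then obtain b bs where xsb: "xs = b # bs" and "(b, bs) \<in> U \<times> G m \<union> Sigma (?V - K) L" by auto
    then consider "b \<in> U" "bs \<in> G m" | "b \<in> ?V" "b \<notin> K" "bs \<in> L b" by auto
    then show "xs \<in> G (Suc m)"
    proof cases
      case 1
      then show ?thesis using UV UK by (auto simp: xsb G_def adjoin_vec_absorb[OF U])
    next
      case 2
      then have bU: "b \<notin> U" using UK by auto
      note A = vec_subspace_adjoin[OF U 2(1)]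
      have "set bs \<subseteq> adjoin_vec U b" using 2(3) by (simp add: L_def)
      moreover have "adjoin_vec U b \<subseteq> ?V" using vec_subspaceD(1)[OF A] .
      ultimately have bs: "set bs \<subseteq> ?V" "card (foldl adjoin_vec (adjoin_vec U b) bs) = ?q * card U"
        using card_foldl_adjoin_vec_eq_iff[OF A, of bs] card_adjoin_vec[OF U 2(1) bU] by auto
      then show ?thesis using 2 by (auto simp: xsb G_def L_def)
    qed
  qed
  have finL: "finite (L b)" and cardL: "card (L b) = (?q * card U) ^ m" if "b \<in> ?V - K" for b
  proof -
    have "finite (adjoin_vec U b)" using that vec_subspace_adjoin[OF U] vec_subspace_finite by blast
    then show "finite (L b)" unfolding L_def
      using finite_lists_length_eq[of "adjoin_vec U b" m] by (simp add: conj_commute)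
    show "card (L b) = (?q * card U) ^ m"
      unfolding L_def using card_lists_over[OF \<open>finite (adjoin_vec U b)\<close>] card_adjoin_vec[OF U, of b] that UK
      by (metis DiffD1 DiffD2 subsetD)
  qed
  have finG: "finite (G m)"
    by (rule finite_subset[OF _ finite_lists_length_eq[OF finite_card_carrier_vec(1), of n m]]) (auto simp: G_def)
  have inj: "inj_on (\<lambda>(b, bs). b # bs) A" for A :: "('a vec \<times> 'a vec list) set"
    by (auto simp: inj_on_def)
  have "card (G (Suc m)) = card (U \<times> G m) + card (Sigma (?V - K) L)"
    unfolding eq card_image[OF inj]
    using fin finG finL finite_card_carrier_vec(1) UK by (intro card_Un_disjoint finite_SigmaI) auto
  also have "card (Sigma (?V - K) L) = (?q ^ n - card K) * (?q * card U) ^ m"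
    using finite_card_carrier_vec[where 'a = 'a, of n] finL cardL by (simp add: card_Diff_subset[OF fin(2) KV])
  \<comment> \<open>This is the recursion of a geometric sum with ratios |U| and q |U|, indexed by
    the position of the first vector outside \<open>U\<close>. The statement carries the denominator
    q |U| - |U| of the closed form as a factor on the left.\<close>
  finally have "card (G (Suc m)) = card U * card (G m) + (?q ^ n - card K) * (?q * card U) ^ m"
    by (simp add: card_cartesian_product)
  moreover have "card K \<le> ?q ^ n" using card_mono[OF finite_card_carrier_vec(1) KV] by (simp add: finite_card_carrier_vec)
  ultimately have "real (card (G (Suc m))) = real (card U) * real (card (G m)) +
      (real (?q ^ n) - real (card K)) * real (?q * card U) ^ m"
    by (simp add: of_nat_diff)
  with Suc[folded G_def] have "real (card (G (Suc m))) * (real (?q * card U) - real (card U)) =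
     real (card U) * ((real (?q ^ n) - real (card K)) * (real (?q * card U) ^ m - real (card U) ^ m)) +
      (real (?q ^ n) - real (card K)) * real (?q * card U) ^ m * (real (?q * card U) - real (card U))"
    by (simp only: distrib_right mult.assoc)
  also have "\<dots> = (real (?q ^ n) - real (card K)) * (real (?q * card U) ^ Suc m - real (card U) ^ Suc m)"
    by (simp add: algebra_simps)
  finally show ?case unfolding G_def .
qed

lemma mat_of_cols_Cons_mult_vCons:
  assumes "b \<in> carrier_vec n" "set bs \<subseteq> carrier_vec n" "w \<in> carrier_vec (length bs)"
  shows "mat_of_cols n (b # bs) *\<^sub>v vCons c w = c \<cdot>\<^sub>v (b :: 'a::field vec) + mat_of_cols n bs *\<^sub>v w"
proof (rule eq_vecI)
  fix i assume "i < dim_vec (c \<cdot>\<^sub>v b + mat_of_cols n bs *\<^sub>v w)"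
  then have i: "i < n" by simp
  have "row (mat_of_cols n (b # bs)) i = vCons (b $ i) (row (mat_of_cols n bs) i)"
  proof (rule eq_vecI)
    fix j assume "j < dim_vec (vCons (b $ i) (row (mat_of_cols n bs) i))"
    then show "row (mat_of_cols n (b # bs)) i $ j = vCons (b $ i) (row (mat_of_cols n bs) i) $ j"
      using i by (cases j) (auto simp: mat_of_cols_index)
  qed simp
  then show "(mat_of_cols n (b # bs) *\<^sub>v vCons c w) $ i = (c \<cdot>\<^sub>v b + mat_of_cols n bs *\<^sub>v w) $ i"
    using i assms by simp
qed (use assms in simp)

text \<open>Translates between the column-by-column span, which is suited to counting, and images
  under a matrix, which is the form in which the range of a bordered matrix arises.\<close>

lemma foldl_adjoin_vec_eq:
  assumes "vec_subspace n S" "set bs \<subseteq> carrier_vec n"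
  shows "foldl adjoin_vec S bs =
    {s + mat_of_cols n bs *\<^sub>v w | s w. s \<in> S \<and> w \<in> carrier_vec (length bs)}"
  using assms
proof (induction bs arbitrary: S)
  case Nil
  have *: "s + mat_of_cols n [] *\<^sub>v w = s" if "s \<in> S" "w \<in> carrier_vec 0" for s w
  proof -
    have "mat_of_cols n [] *\<^sub>v w = 0\<^sub>v n" using that by (intro eq_vecI) (auto simp: scalar_prod_def)
    then show ?thesis using that vec_subspaceD(1)[OF Nil(1)] by auto
  qed
  show ?case
  proof (intro equalityI subsetI)
    fix s assume "s \<in> foldl adjoin_vec S []"
    then have "s = s + mat_of_cols n [] *\<^sub>v 0\<^sub>v 0" "s \<in> S" using *[of s "0\<^sub>v 0"] by simp_all
    then show "s \<in> {s + mat_of_cols n [] *\<^sub>v w | s w. s \<in> S \<and> w \<in> carrier_vec (length [])}"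
      using zero_carrier_vec[of 0] by force
  qed (auto simp: *)
next
  case (Cons b bs)
  have b: "b \<in> carrier_vec n" and bs: "set bs \<subseteq> carrier_vec n" using Cons.prems by auto
  have SV: "S \<subseteq> carrier_vec n" using vec_subspaceD(1) Cons.prems by auto
  have M: "mat_of_cols n bs \<in> carrier_mat n (length bs)" by simp
  \<comment> \<open>A multiple of \<open>b\<close> can be counted with the subspace or as the first
    entry of the coefficient vector; the induction moves it from one place to the other.\<close>
  have step: "s + mat_of_cols n (b # bs) *\<^sub>v vCons c w = (s + c \<cdot>\<^sub>v b) + mat_of_cols n bs *\<^sub>v w"
    if "s \<in> S" "w \<in> carrier_vec (length bs)" for s c w
    unfolding mat_of_cols_Cons_mult_vCons[OF b bs that(2)]
    using that SV b by (intro eq_vecI) (auto simp: add.assoc)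
  have "foldl adjoin_vec S (b # bs) =
     {s + mat_of_cols n bs *\<^sub>v w | s w. s \<in> adjoin_vec S b \<and> w \<in> carrier_vec (length bs)}"
    using Cons.IH[OF vec_subspace_adjoin[OF Cons.prems(1) b] bs] by simp
  also have "\<dots> = {s + mat_of_cols n (b # bs) *\<^sub>v w | s w. s \<in> S \<and> w \<in> carrier_vec (Suc (length bs))}"
  proof (intro equalityI subsetI)
    fix x assume "x \<in> {s + mat_of_cols n bs *\<^sub>v w | s w. s \<in> adjoin_vec S b \<and> w \<in> carrier_vec (length bs)}"
    then obtain s c w where "s \<in> S" "w \<in> carrier_vec (length bs)" "x = s + c \<cdot>\<^sub>v b + mat_of_cols n bs *\<^sub>v w"
      by (auto elim!: adjoin_vecE)
    then have "x = s + mat_of_cols n (b # bs) *\<^sub>v vCons c w" "s \<in> S" "vCons c w \<in> carrier_vec (Suc (length bs))"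
      using step by simp_all
    then show "x \<in> {s + mat_of_cols n (b # bs) *\<^sub>v w | s w. s \<in> S \<and> w \<in> carrier_vec (Suc (length bs))}" by blast
  next
    fix x assume "x \<in> {s + mat_of_cols n (b # bs) *\<^sub>v w | s w. s \<in> S \<and> w \<in> carrier_vec (Suc (length bs))}"
    then obtain s v where *: "s \<in> S" "v \<in> carrier_vec (Suc (length bs))" "x = s + mat_of_cols n (b # bs) *\<^sub>v v"
      by auto
    then obtain c w where v: "v = vCons c w" "w \<in> carrier_vec (length bs)"
      by (cases v rule: vec_cases) auto
    have "x = (s + c \<cdot>\<^sub>v b) + mat_of_cols n bs *\<^sub>v w" "s + c \<cdot>\<^sub>v b \<in> adjoin_vec S b"
      using step[OF *(1) v(2), of c] *(3) v(1) adjoin_vecI[OF *(1)] by auto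
    then show "x \<in> {s + mat_of_cols n bs *\<^sub>v w | s w. s \<in> adjoin_vec S b \<and> w \<in> carrier_vec (length bs)}"
      using v(2) by blast
  qed
  finally show ?case by simp
qed

section \<open>Adding a block\<close>

text \<open>For nilpotent matrices this means Jordan type (k+1, 1, ..., 1), with rank k read off
  from the size of the range. For k = 0 it describes the zero matrix of positive size: the zeroth
  power is the identity, which is nonzero unless the size is 0.\<close>

definition hook_type :: "nat \<Rightarrow> 'a::{field,finite} mat \<Rightarrow> bool" where
  "hook_type k X \<longleftrightarrow> card (mat_range X) = CARD('a) ^ k \<and> X ^\<^sub>m k \<noteq> 0\<^sub>m (dim_row X) (dim_row X)"

lemma hook_type_inject: "hook_type k (X :: 'a::{field,finite} mat) \<Longrightarrow> hook_type l X \<Longrightarrow> k = l"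
  using field_card_ge_2[where 'a = 'a] by (auto simp: hook_type_def power_inject_exp)

definition bordered_mat :: "'a::field mat \<Rightarrow> 'a mat \<Rightarrow> 'a mat" where
  "bordered_mat X B = four_block_mat X B (0\<^sub>m (dim_col B) (dim_row X)) (0\<^sub>m (dim_col B) (dim_col B))"

context
  fixes X B :: "'a::field mat" and n m :: nat
  assumes X: "X \<in> carrier_mat n n" and B: "B \<in> carrier_mat n m"
begin

lemma bordered_mat_carrier: "bordered_mat X B \<in> carrier_mat (n + m) (n + m)"
  using X B by (auto simp: bordered_mat_def)

lemma bordered_mat_mult_append:
  assumes "v \<in> carrier_vec n" "w \<in> carrier_vec m"
  shows "bordered_mat X B *\<^sub>v (v @\<^sub>v w) = (X *\<^sub>v v + B *\<^sub>v w) @\<^sub>v 0\<^sub>v m"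
proof -
  have "dim_col B = m" "dim_row X = n" using X B by auto
  then have "bordered_mat X B *\<^sub>v (v @\<^sub>v w) =
      (X *\<^sub>v v + B *\<^sub>v w) @\<^sub>v (0\<^sub>m m n *\<^sub>v v + 0\<^sub>m m m *\<^sub>v w)"
    unfolding bordered_mat_def using four_block_mat_mult_vec[OF X B, of "0\<^sub>m m n" m "0\<^sub>m m m"] assms by auto
  then show ?thesis using zero_mat_mult_vec[OF assms(1), of m] zero_mat_mult_vec[OF assms(2), of m] by simp
qed

lemma range_bordered_mat:
  "mat_range (bordered_mat X B) = (\<lambda>w. w @\<^sub>v 0\<^sub>v m) ` foldl adjoin_vec (mat_range X) (cols B)"
proof -
  have eq: "mat_of_cols n (cols B) = B" using B mat_of_cols_cols[of B] by simp
  have fold: "foldl adjoin_vec (mat_range X) (cols B) = {X *\<^sub>v v + B *\<^sub>v w | v w. v \<in> carrier_vec n \<and> w \<in> carrier_vec m}"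
    using foldl_adjoin_vec_eq[OF vec_subspace_mat_range[OF X], of "cols B"] X B cols_dim[of B]
    by (auto simp: eq mat_range_def)
  have V: "carrier_vec (n + m) = {v @\<^sub>v w | v w. v \<in> (carrier_vec n :: 'a vec set) \<and> w \<in> carrier_vec m}"
    proof (intro equalityI subsetI)
    fix v :: "'a vec" assume "v \<in> carrier_vec (n + m)"
    then have "v = vec_first v n @\<^sub>v vec_last v m" by simp
    moreover have "vec_first v n \<in> carrier_vec n" "vec_last v m \<in> carrier_vec m" by simp_all
    ultimately show "v \<in> {v @\<^sub>v w | v w. v \<in> carrier_vec n \<and> w \<in> carrier_vec m}" by blast
  qed auto
  have car: "mat_range (bordered_mat X B) =
      {bordered_mat X B *\<^sub>v (v @\<^sub>v w) | v w. v \<in> carrier_vec n \<and> w \<in> carrier_vec m}"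
    unfolding mat_range_def carrier_matD(2)[OF bordered_mat_carrier] V by blast
  have "mat_range (bordered_mat X B) =
      {(X *\<^sub>v v + B *\<^sub>v w) @\<^sub>v 0\<^sub>v m | v w. v \<in> carrier_vec n \<and> w \<in> carrier_vec m}"
    unfolding car by (intro Collect_cong ex_cong1) (auto simp: bordered_mat_mult_append)
  then show ?thesis unfolding fold by blast
qed

text \<open>The range of the bordered matrix consists of vectors with zero lower part, and on such
  vectors the matrix acts as \<open>X\<close>. This is what reduces its powers to powers of
  \<open>X\<close>.\<close>

lemma bordered_mat_pow_append:
  assumes "w \<in> carrier_vec n"
  shows "bordered_mat X B ^\<^sub>m k *\<^sub>v (w @\<^sub>v 0\<^sub>v m) = (X ^\<^sub>m k *\<^sub>v w) @\<^sub>v 0\<^sub>v m"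
proof (induction k)
  case 0
  then show ?case using assms bordered_mat_carrier X by auto
next
  case (Suc k)
  have "bordered_mat X B ^\<^sub>m Suc k *\<^sub>v (w @\<^sub>v 0\<^sub>v m) = bordered_mat X B *\<^sub>v (bordered_mat X B ^\<^sub>m k *\<^sub>v (w @\<^sub>v 0\<^sub>v m))"
    unfolding pow_mat_Suc_left[OF bordered_mat_carrier] using assms bordered_mat_carrier
    by (intro assoc_mult_mat_vec) auto
  also have "\<dots> = (X *\<^sub>v (X ^\<^sub>m k *\<^sub>v w)) @\<^sub>v 0\<^sub>v m"
    proof -
    have "X ^\<^sub>m k *\<^sub>v w \<in> carrier_vec n" using X assms by (intro mult_mat_vec_carrier) auto
    moreover have "B *\<^sub>v 0\<^sub>v m = 0\<^sub>v n" using B by auto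
    ultimately show ?thesis unfolding Suc using X by (subst bordered_mat_mult_append) auto
  qed
  also have "X *\<^sub>v (X ^\<^sub>m k *\<^sub>v w) = X ^\<^sub>m Suc k *\<^sub>v w"
    unfolding pow_mat_Suc_left[OF X] using assms X by (intro assoc_mult_mat_vec[symmetric]) auto
  finally show ?case .
qed

end

lemma range_subset_null_pow_iff:
  assumes X: "X \<in> carrier_mat n n"
  shows "mat_range X \<subseteq> mat_null (X ^\<^sub>m k) \<longleftrightarrow> X ^\<^sub>m Suc k = 0\<^sub>m n n"
proof -
  have P: "X ^\<^sub>m k \<in> carrier_mat n n" "X ^\<^sub>m Suc k \<in> carrier_mat n n" using X by auto
  have "X ^\<^sub>m Suc k = 0\<^sub>m n n \<longleftrightarrow> (\<forall>v\<in>carrier_vec n. X ^\<^sub>m Suc k *\<^sub>v v = 0\<^sub>v n)"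
    by (rule mat_eq_0_iff[OF P(2)])
  also have "\<dots> \<longleftrightarrow> (\<forall>v\<in>carrier_vec n. X ^\<^sub>m k *\<^sub>v (X *\<^sub>v v) = 0\<^sub>v n)"
  proof (rule ball_cong[OF refl])
    fix v :: "'a vec" assume "v \<in> carrier_vec n"
    then show "(X ^\<^sub>m Suc k *\<^sub>v v = 0\<^sub>v n) = (X ^\<^sub>m k *\<^sub>v (X *\<^sub>v v) = 0\<^sub>v n)"
      using assoc_mult_mat_vec[OF P(1) X] by simp
  qed
  also have "\<dots> \<longleftrightarrow> mat_range X \<subseteq> mat_null (X ^\<^sub>m k)"
    unfolding mat_range_def mat_null_def carrier_matD[OF P(1)] carrier_matD[OF X]
    using mult_mat_vec_carrier[OF X] by blast
  finally show ?thesis by (rule sym)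
qed

text \<open>The power k+1 of the bordered matrix vanishes exactly if its power k kills its own
  range; that range is a copy of \<open>W\<close>, on which the power acts as X^k.\<close>

lemma hook_type_bordered_mat:
  assumes X: "(X :: 'a::{field,finite} mat) \<in> carrier_mat n n" and B: "B \<in> carrier_mat n m"
  defines "W \<equiv> foldl adjoin_vec (mat_range X) (cols B)"
  shows "hook_type (Suc k) (bordered_mat X B) \<longleftrightarrow>
    card W = CARD('a) ^ Suc k \<and> \<not> W \<subseteq> mat_null (X ^\<^sub>m k)"
proof -
  note R = range_bordered_mat[OF X B, folded W_def] and C = bordered_mat_carrier[OF X B]
  have sub: "vec_subspace n W" unfolding W_def
    using foldl_adjoin_vec(1)[OF vec_subspace_mat_range[OF X]] cols_dim[of B] B by auto
  note WV = vec_subspaceD(1)[OF sub]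
  have "inj_on (\<lambda>w. w @\<^sub>v 0\<^sub>v m) W"
  proof (rule inj_onI)
    fix w w' assume "w \<in> W" "w' \<in> W" and eq: "w @\<^sub>v 0\<^sub>v m = w' @\<^sub>v 0\<^sub>v m"
    then have "w \<in> carrier_vec n" "w' \<in> carrier_vec n" using WV by auto
    from append_vec_eq[OF this] eq show "w = w'" by simp
  qed
  then have card: "card (mat_range (bordered_mat X B)) = card W" unfolding R by (rule card_image)
  have P: "bordered_mat X B ^\<^sub>m k \<in> carrier_mat (n + m) (n + m)" "X ^\<^sub>m k \<in> carrier_mat n n" using C X by auto
  have "bordered_mat X B ^\<^sub>m Suc k = 0\<^sub>m (n + m) (n + m) \<longleftrightarrow>
      mat_range (bordered_mat X B) \<subseteq> mat_null (bordered_mat X B ^\<^sub>m k)"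
    by (rule range_subset_null_pow_iff[OF C, symmetric])
  also have "\<dots> \<longleftrightarrow> W \<subseteq> mat_null (X ^\<^sub>m k)"
  proof -
    have "w @\<^sub>v 0\<^sub>v m \<in> mat_null (bordered_mat X B ^\<^sub>m k) \<longleftrightarrow> w \<in> mat_null (X ^\<^sub>m k)" if "w \<in> W" for w
    proof -
      have w: "w \<in> carrier_vec n" using that WV by auto
      have Xw: "X ^\<^sub>m k *\<^sub>v w \<in> carrier_vec n" using P(2) w by (rule mult_mat_vec_carrier)
      have "0\<^sub>v (n + m) = 0\<^sub>v n @\<^sub>v (0\<^sub>v m :: 'a vec)" by (rule eq_vecI) auto
      then have "(X ^\<^sub>m k *\<^sub>v w) @\<^sub>v 0\<^sub>v m = 0\<^sub>v (n + m) \<longleftrightarrow> X ^\<^sub>m k *\<^sub>v w = 0\<^sub>v n"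
        using append_vec_eq[OF Xw zero_carrier_vec] by auto
      then show ?thesis using bordered_mat_pow_append[OF X B w, of k] w C X P
        by (simp add: mat_null_def carrier_matD[OF P(1)] carrier_matD[OF P(2)])
    qed
    then show ?thesis unfolding R by blast
  qed
  finally show ?thesis using card C by (simp add: hook_type_def)
qed

section \<open>Number of borders of a fixed nilpotent matrix\<close>

context
  fixes X :: "'a::{field,finite} mat" and n N :: nat
  assumes X: "X \<in> carrier_mat n n" and nil: "X ^\<^sub>m N = 0\<^sub>m n n"
begin

text \<open>Otherwise X^(k+1) would have rank at least one, and the k strict drops from
  \<open>X\<close> to X^(k+1) would give \<open>X\<close> a rank of at least k+1.\<close>

lemma pow_eq_0_if_hook_type:
  assumes "hook_type k X"
  shows "X ^\<^sub>m Suc k = 0\<^sub>m n n"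
proof (rule ccontr)
  assume nz: "X ^\<^sub>m Suc k \<noteq> 0\<^sub>m n n"
  have "CARD('a) ^ k * card (mat_range (X ^\<^sub>m Suc k)) \<le> CARD('a) ^ k"
    using card_mat_range_pow[OF X nil, of 1 k] nz assms X by (simp add: hook_type_def)
  then have "card (mat_range (X ^\<^sub>m Suc k)) \<le> 1" by simp
  moreover have "CARD('a) \<le> card (mat_range (X ^\<^sub>m Suc k))"
    using X nz by (intro card_field_le_card_range[of _ n n]) auto
  ultimately show False using field_card_ge_2[where 'a = 'a] by simp
qed

text \<open>For positive k, the k-1 strict drops from \<open>X\<close> to X^k leave rank at most
  one, and X^k is nonzero, so the kernel is a hyperplane. For k = 0 the power is the identity, whose
  kernel is zero.\<close>

lemma card_null_pow_hook_type:
  assumes "hook_type k X"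
  shows "real (card (mat_null (X ^\<^sub>m k))) = (if k = 0 then 1 else real (CARD('a) ^ n) / real CARD('a))"
proof -
  have Xk: "X ^\<^sub>m k \<in> carrier_mat n n" using X by simp
  show ?thesis
  proof (cases k)
    case 0
    then have "mat_null (X ^\<^sub>m k) = {0\<^sub>v n}" using X by (auto simp: mat_null_def)
    then show ?thesis using 0 by simp
  next
    case (Suc j)
    have "CARD('a) ^ j * card (mat_range (X ^\<^sub>m k)) \<le> CARD('a) ^ j * CARD('a)"
      using card_mat_range_pow[OF X nil, of 1 j] assms X by (simp add: hook_type_def Suc mult.commute)
    then have "card (mat_range (X ^\<^sub>m k)) \<le> CARD('a)" by simp
    moreover have "CARD('a) \<le> card (mat_range (X ^\<^sub>m k))"
      using assms X by (intro card_field_le_card_range[OF Xk]) (auto simp: hook_type_def)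
    ultimately have "CARD('a) * card (mat_null (X ^\<^sub>m k)) = CARD('a) ^ n"
      using rank_nullity_card[OF Xk] by simp
    then have "real CARD('a) * real (card (mat_null (X ^\<^sub>m k))) = real (CARD('a) ^ n)"
      by (metis of_nat_mult)
    then show ?thesis using Suc by (simp add: field_simps)
  qed
qed

lemma card_range_ge_if_pow_neq_0:
  assumes "X ^\<^sub>m k \<noteq> 0\<^sub>m n n"
  shows "CARD('a) ^ k \<le> card (mat_range X)"
proof (cases k)
  case 0
  then show ?thesis using vec_subspace_card_pos[OF vec_subspace_mat_range[OF X]] by simp
next
  case (Suc j)
  have "CARD('a) \<le> card (mat_range (X ^\<^sub>m k))"
    using assms X by (intro card_field_le_card_range[of _ n n]) auto
  then have "CARD('a) ^ j * CARD('a) \<le> CARD('a) ^ j * card (mat_range (X ^\<^sub>m k))" by simp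
  also have "\<dots> \<le> card (mat_range X)"
    using card_mat_range_pow[OF X nil, of 1 j] assms X by (simp add: Suc)
  finally show ?thesis using Suc by (simp add: mult.commute)
qed

text \<open>Choosing \<open>B\<close> amounts to choosing its list of columns. The two summands are
  the two ways to reach rank k+1: all columns in the range of \<open>X\<close>, or a growth by one
  dimension counted by \<open>card_one_step_extensions\<close>. By \<open>hook_type_inject\<close>
  at most one of them is present.\<close>

lemma card_bordered_mat_hook_type:
  "real (card {B \<in> carrier_mat n m. hook_type (Suc k) (bordered_mat X B)}) =
     (if hook_type (Suc k) X then real CARD('a) ^ (Suc k * m) else 0) +
     (if hook_type k X then (real CARD('a) ^ n - (if k = 0 then 1 else real CARD('a) ^ n / real CARD('a))) *
        (real CARD('a) ^ (Suc k * m) - real CARD('a) ^ (k * m)) / (real CARD('a) ^ Suc k - real CARD('a) ^ k) else 0)"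
proof -
  let ?q = "CARD('a)" and ?K = "mat_null (X ^\<^sub>m k)" and ?U = "mat_range X"
  define L where "L = {bs. length bs = m \<and> set bs \<subseteq> carrier_vec n \<and>
     \<not> foldl adjoin_vec ?U bs \<subseteq> ?K \<and> card (foldl adjoin_vec ?U bs) = ?q ^ Suc k}"
  have U: "vec_subspace n ?U" by (rule vec_subspace_mat_range[OF X])
  have K: "vec_subspace n ?K" using X by (intro vec_subspace_mat_null) auto
  have q: "2 \<le> ?q" by (rule field_card_ge_2)
  have "bij_betw cols {B \<in> carrier_mat n m. hook_type (Suc k) (bordered_mat X B)} L"
  proof (rule bij_betw_byWitness[where f' = "mat_of_cols n"])
    show "\<forall>B\<in>{B \<in> carrier_mat n m. hook_type (Suc k) (bordered_mat X B)}. mat_of_cols n (cols B) = B"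
      using mat_of_cols_cols by auto
    show "\<forall>bs\<in>L. cols (mat_of_cols n bs) = bs" by (auto simp: L_def)
    show "cols ` {B \<in> carrier_mat n m. hook_type (Suc k) (bordered_mat X B)} \<subseteq> L"
    proof clarify
      fix B assume B: "B \<in> carrier_mat n m" and h: "hook_type (Suc k) (bordered_mat X B)"
      have "set (cols B) \<subseteq> carrier_vec n" using cols_dim[of B] B by simp
      with B h hook_type_bordered_mat[OF X B, of k] show "cols B \<in> L" by (simp add: L_def)
    qed
    show "mat_of_cols n ` L \<subseteq> {B \<in> carrier_mat n m. hook_type (Suc k) (bordered_mat X B)}"
    proof clarify
      fix bs assume bs: "bs \<in> L"
      then have B: "mat_of_cols n bs \<in> carrier_mat n m" by (auto simp: L_def)
      with bs hook_type_bordered_mat[OF X B, of k]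
      show "mat_of_cols n bs \<in> carrier_mat n m \<and> hook_type (Suc k) (bordered_mat X (mat_of_cols n bs))"
        by (auto simp: L_def)
    qed
  qed
  then have card: "card {B \<in> carrier_mat n m. hook_type (Suc k) (bordered_mat X B)} = card L"
    by (rule bij_betw_same_card)
  consider (full) "hook_type (Suc k) X" | (step) "hook_type k X" | (none) "\<not> hook_type (Suc k) X" "\<not> hook_type k X"
    by blast
  then show ?thesis
  proof cases
    case full
    \<comment> \<open>Since X^(k+1) is nonzero, the range of \<open>X\<close> alone already leaves
      the kernel of X^k, so the only demand on the columns is that they add no dimension.\<close>
    then have c: "card ?U = ?q ^ Suc k" and UK: "\<not> ?U \<subseteq> ?K"
      using range_subset_null_pow_iff[OF X] X by (auto simp: hook_type_def)
    have "L = {bs. length bs = m \<and> set bs \<subseteq> ?U}"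
      unfolding L_def c[symmetric]
      using card_foldl_adjoin_vec_eq_iff[OF U] foldl_adjoin_vec_subset_iff[OF U K] UK vec_subspaceD(1)[OF U]
      by blast
    then have "card L = (?q ^ Suc k) ^ m" using card_lists_over[OF vec_subspace_finite[OF U]] c by simp
    then have "real (card L) = real ?q ^ (Suc k * m)" by (simp only: of_nat_power power_mult)
    moreover have "\<not> hook_type k X" using hook_type_inject[OF full, of k] by auto
    ultimately show ?thesis using full card by simp
  next
    case step
    \<comment> \<open>Here X^(k+1) = 0 puts the range of \<open>X\<close> inside the kernel of X^k,
      so it is up to the new columns to leave that kernel.\<close>
    then have c: "card ?U = ?q ^ k" and UK: "?U \<subseteq> ?K"
      using range_subset_null_pow_iff[OF X] pow_eq_0_if_hook_type[OF step] by (auto simp: hook_type_def)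
    have "L = {bs. length bs = m \<and> set bs \<subseteq> carrier_vec n \<and> \<not> set bs \<subseteq> ?K \<and>
            card (foldl adjoin_vec ?U bs) = ?q * card ?U}"
      unfolding L_def using c foldl_adjoin_vec_subset_iff[OF U K] UK
      by (intro Collect_cong) (metis power_Suc)
    then have "real (card L) * (real (?q * card ?U) - real (card ?U)) =
         (real (?q ^ n) - real (card ?K)) * (real (?q * card ?U) ^ m - real (card ?U) ^ m)"
      using card_one_step_extensions[OF U K UK, of m] by simp
    then have "real (card L) * (real ?q ^ Suc k - real ?q ^ k) = (real ?q ^ n - real (card ?K)) *
        (real ?q ^ (Suc k * m) - real ?q ^ (k * m))"
      unfolding c by (simp add: power_mult power_mult_distrib power_add)
    moreover have "real ?q ^ Suc k - real ?q ^ k \<noteq> 0" using q by simp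
    moreover have "\<not> hook_type (Suc k) X" using hook_type_inject[OF step, of "Suc k"] by auto
    ultimately show ?thesis
      using step card card_null_pow_hook_type[OF step] by (simp add: nonzero_eq_divide_eq)
  next
    case none
    have "L = {}"
    proof (rule ccontr)
      assume "L \<noteq> {}"
      then obtain bs where bs: "set bs \<subseteq> carrier_vec n" "\<not> foldl adjoin_vec ?U bs \<subseteq> ?K"
        "card (foldl adjoin_vec ?U bs) = ?q ^ Suc k" by (auto simp: L_def)
      note F = foldl_adjoin_vec[OF U bs(1)]
      show False
      proof (cases "?U = foldl adjoin_vec ?U bs")
        case True
        then have "hook_type (Suc k) X"
          using bs range_subset_null_pow_iff[OF X, of k] X by (simp add: hook_type_def)
        with none show False by simp
      next
        case False
        \<comment> \<open>The span has dimension k+1 and properly contains the range of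
          \<open>X\<close>, which bounds the rank of \<open>X\<close> by k; X^k being nonzero gives
          the opposite bound, hence type k.\<close>
        then have "?q * card ?U \<le> ?q * ?q ^ k"
          using card_psubspace[OF U F(1)] F(2) bs(3) by auto
        then have le: "card ?U \<le> ?q ^ k" using q by simp
        have nz: "X ^\<^sub>m k \<noteq> 0\<^sub>m n n"
        proof
          assume "X ^\<^sub>m k = 0\<^sub>m n n"
          then have "?K = carrier_vec n" by (auto simp: mat_null_def zero_mat_mult_vec)
          then show False using bs(2) vec_subspaceD(1)[OF F(1)] by simp
        qed
        from card_range_ge_if_pow_neq_0[OF nz] le nz X have "hook_type k X"
          by (simp add: hook_type_def)
        with none show False by simp
      qed
    qed
    then show ?thesis using none card by simp
  qed
qed

end

section \<open>Decomposition of the nilradical along its last block\<close>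

lemma block_index_append:
  shows "i < sum_list lam \<Longrightarrow> block_index (lam @ [m]) i = block_index lam i"
    and "i < sum_list lam \<Longrightarrow> block_index lam i < length lam"
    and "sum_list lam \<le> i \<Longrightarrow> i < sum_list lam + m \<Longrightarrow> block_index (lam @ [m]) i = length lam"
proof -
  assume i: "i < sum_list lam"
  then have "lam \<noteq> []" by auto
  \<comment> \<open>The last index of \<open>lam\<close> satisfies the condition under
    \<open>LEAST\<close>, which bounds the least such index by it.\<close>
  then have "i < sum_list (take (Suc (length lam - 1)) lam)" using i by simp
  note L = LeastI[of "\<lambda>t. i < sum_list (take (Suc t) lam)", OF this] Least_le[of "\<lambda>t. i < sum_list (take (Suc t) lam)", OF this]
  show lt: "block_index lam i < length lam"
    using L(2) \<open>lam \<noteq> []\<close> unfolding block_index_def by (cases lam) auto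
  show "block_index (lam @ [m]) i = block_index lam i"
    unfolding block_index_def[of "lam @ [m]"]
  proof (rule Least_equality)
    show "i < sum_list (take (Suc (block_index lam i)) (lam @ [m]))"
      using L(1) lt by (simp add: block_index_def)
    fix t assume t: "i < sum_list (take (Suc t) (lam @ [m]))"
    show "block_index lam i \<le> t"
    proof (rule ccontr)
      assume "\<not> block_index lam i \<le> t"
      then have "i < sum_list (take (Suc t) lam)" using t lt by simp
      then have "block_index lam i \<le> t" unfolding block_index_def by (rule Least_le)
      with \<open>\<not> block_index lam i \<le> t\<close> show False by simp
    qed
  qed
next
  assume i: "sum_list lam \<le> i" "i < sum_list lam + m"
  show "block_index (lam @ [m]) i = length lam"
    unfolding block_index_def
  proof (rule Least_equality)
    fix t assume t: "i < sum_list (take (Suc t) (lam @ [m]))"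
    show "length lam \<le> t"
    proof (rule ccontr)
      assume "\<not> length lam \<le> t"
      then have "i < sum_list (take (Suc t) lam)" using t by simp
      also have "\<dots> \<le> sum_list lam" using sum_list_append[of "take (Suc t) lam" "drop (Suc t) lam"] by simp
      finally show False using i by simp
    qed
  qed (use i in simp)
qed

text \<open>The inverse cuts out the upper left and upper right blocks. Nothing is lost, since the
  rows of the last block are zero, and the upper right block is unconstrained, since its columns
  belong to a strictly later block than its rows.\<close>

lemma parabolic_nilradical_append:
  "bij_betw (\<lambda>(X, B). bordered_mat X B) (parabolic_nilradical lam \<times> carrier_mat (sum_list lam) m)
     (parabolic_nilradical (lam @ [m]) :: 'a::field mat set)"
proof (rule bij_betw_byWitness[where f' = "\<lambda>Y. (mat (sum_list lam) (sum_list lam) (\<lambda>(i, j). Y $$ (i, j)),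
    mat (sum_list lam) m (\<lambda>(i, j). Y $$ (i, sum_list lam + j)))"])
  let ?n = "sum_list lam"
  let ?f = "\<lambda>(X, B). bordered_mat X B :: 'a mat"
  let ?g = "\<lambda>Y :: 'a mat. (mat ?n ?n (\<lambda>(i, j). Y $$ (i, j)), mat ?n m (\<lambda>(i, j). Y $$ (i, ?n + j)))"
  note bi = block_index_append
  \<comment> \<open>No block index exceeds that of the last block, so its rows contain no admissible
    position.\<close>
  have low: "Y $$ (i, j) = 0" if "Y \<in> parabolic_nilradical (lam @ [m])" "?n \<le> i" "i < ?n + m" "j < ?n + m"
    for Y :: "'a mat" and i j
  proof -
    have "block_index (lam @ [m]) i = length lam" using that bi(3)[of lam i m] by simp
    moreover have "block_index (lam @ [m]) j \<le> length lam"
      using that bi(1,2)[of j lam] bi(3)[of lam j m] by (cases "j < ?n") auto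
    ultimately show ?thesis using that by (auto simp: parabolic_nilradical_def)
  qed
  show "\<forall>p\<in>parabolic_nilradical lam \<times> carrier_mat ?n m. ?g (?f p) = p"
  proof
    fix p :: "'a mat \<times> 'a mat" assume "p \<in> parabolic_nilradical lam \<times> carrier_mat ?n m"
    moreover obtain X B where p: "p = (X, B)" by (cases p)
    ultimately have "X \<in> carrier_mat ?n ?n" "B \<in> carrier_mat ?n m" by (auto simp: parabolic_nilradical_def)
    then show "?g (?f p) = p"
      unfolding p by (auto simp: bordered_mat_def intro!: eq_matI)
  qed
  show "\<forall>Y\<in>parabolic_nilradical (lam @ [m]). ?f (?g Y) = Y"
  proof
    fix Y :: "'a mat" assume Y: "Y \<in> parabolic_nilradical (lam @ [m])"
    then have "Y \<in> carrier_mat (?n + m) (?n + m)" by (auto simp: parabolic_nilradical_def)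
    then show "?f (?g Y) = Y" using low[OF Y] by (auto simp: bordered_mat_def intro!: eq_matI)
  qed
  show "?f ` (parabolic_nilradical lam \<times> carrier_mat ?n m) \<subseteq> parabolic_nilradical (lam @ [m])"
  proof clarify
    fix X B :: "'a mat" assume *: "X \<in> parabolic_nilradical lam" "B \<in> carrier_mat ?n m"
    then have X: "X \<in> carrier_mat ?n ?n"
      and X0: "\<And>i j. i < ?n \<Longrightarrow> j < ?n \<Longrightarrow> \<not> block_index lam i < block_index lam j \<Longrightarrow> X $$ (i, j) = 0"
      by (auto simp: parabolic_nilradical_def)
    have "bordered_mat X B $$ (i, j) = 0"
      if "i < ?n + m" "j < ?n + m" "\<not> block_index (lam @ [m]) i < block_index (lam @ [m]) j" for i j
    proof -
      have "\<not> (i < ?n \<and> ?n \<le> j)" using bi that by (metis leD leI)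
      moreover have "i < ?n \<Longrightarrow> j < ?n \<Longrightarrow> X $$ (i, j) = 0" using X0 bi that by simp
      ultimately show ?thesis using X *(2) that by (auto simp: bordered_mat_def)
    qed
    then show "bordered_mat X B \<in> parabolic_nilradical (lam @ [m])"
      using bordered_mat_carrier[OF X *(2)] by (simp add: parabolic_nilradical_def)
  qed
  show "?g ` parabolic_nilradical (lam @ [m]) \<subseteq> parabolic_nilradical lam \<times> carrier_mat ?n m"
  proof clarify
    fix Y :: "'a mat" assume Y: "Y \<in> parabolic_nilradical (lam @ [m])"
    have "Y $$ (i, j) = 0" if "i < ?n" "j < ?n" "\<not> block_index lam i < block_index lam j" for i j
      using Y that by (auto simp: parabolic_nilradical_def bi)
    then show "mat ?n ?n (\<lambda>(i, j). Y $$ (i, j)) \<in> parabolic_nilradical lam \<and>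
      mat ?n m (\<lambda>(i, j). Y $$ (i, ?n + j)) \<in> carrier_mat ?n m"
      by (auto simp: parabolic_nilradical_def)
  qed
qed

text \<open>Counting by rank and powers instead of by conjugacy class is what makes the recursion on
  the last block possible; \<open>F_count_hook\<close> identifies the two counts.\<close>

definition nilradical_hook_count :: "'a::{field,finite} itself \<Rightarrow> nat \<Rightarrow> nat list \<Rightarrow> nat" where
  "nilradical_hook_count _ k lam = card {X \<in> (parabolic_nilradical lam :: 'a mat set). hook_type k X}"

lemma parabolic_nilradical_strictly_upper:
  assumes "X \<in> parabolic_nilradical lam" "i < sum_list lam" "j \<le> i"
  shows "X $$ (i, j) = 0"
  using assms block_index_mono[of j i lam] by (auto simp: parabolic_nilradical_def)

lemma finite_carrier_mat: "finite (carrier_mat n m :: 'a::finite mat set)"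
proof (rule finite_subset)
  show "carrier_mat n m \<subseteq> mat_of_cols n ` {bs :: 'a vec list. set bs \<subseteq> carrier_vec n \<and> length bs = m}"
  proof
    fix A :: "'a mat" assume "A \<in> carrier_mat n m"
    then have "A = mat_of_cols n (cols A)" "set (cols A) \<subseteq> carrier_vec n" "length (cols A) = m"
      using mat_of_cols_cols[of A] cols_dim[of A] by auto
    then show "A \<in> mat_of_cols n ` {bs. set bs \<subseteq> carrier_vec n \<and> length bs = m}" by blast
  qed
  show "finite (mat_of_cols n ` {bs :: 'a vec list. set bs \<subseteq> carrier_vec n \<and> length bs = m})"
    by (intro finite_imageI finite_lists_length_eq finite_card_carrier_vec)
qed

text \<open>Every matrix of the larger nilradical arises from exactly one pair of \<open>X\<close>
  and \<open>B\<close>, so the number of admissible \<open>B\<close> is summed over all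
  \<open>X\<close>.\<close>

lemma nilradical_hook_count_append:
  fixes lam :: "nat list"
  defines "q \<equiv> real CARD('a::{field,finite})" and "n \<equiv> sum_list lam"
  shows "real (nilradical_hook_count TYPE('a) (Suc k) (lam @ [m])) =
    q ^ (Suc k * m) * real (nilradical_hook_count TYPE('a) (Suc k) lam) +
    (q ^ n - (if k = 0 then 1 else q ^ n / q)) * (q ^ (Suc k * m) - q ^ (k * m)) / (q ^ Suc k - q ^ k) *
      real (nilradical_hook_count TYPE('a) k lam)"
proof -
  let ?U = "parabolic_nilradical lam :: 'a mat set"
  define e where "e = (q ^ n - (if k = 0 then 1 else q ^ n / q)) * (q ^ (Suc k * m) - q ^ (k * m)) / (q ^ Suc k - q ^ k)"
  have finU: "finite ?U"
    by (rule finite_subset[OF _ finite_carrier_mat]) (auto simp: parabolic_nilradical_def)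
  let ?P = "Sigma ?U (\<lambda>X. {B \<in> carrier_mat n m. hook_type (Suc k) (bordered_mat X B)})"
  have "bij_betw (\<lambda>(X, B). bordered_mat X B) ?P
      {Y \<in> parabolic_nilradical (lam @ [m]). hook_type (Suc k) Y}"
  proof (rule bij_betw_subset[OF parabolic_nilradical_append])
    show "(\<lambda>(X, B). bordered_mat X B) ` ?P = {Y \<in> parabolic_nilradical (lam @ [m]). hook_type (Suc k) Y}"
    proof (intro equalityI subsetI)
      fix Y :: "'a mat" assume "Y \<in> (\<lambda>(X, B). bordered_mat X B) ` ?P"
      then show "Y \<in> {Y \<in> parabolic_nilradical (lam @ [m]). hook_type (Suc k) Y}"
        using bij_betwE[OF parabolic_nilradical_append[of lam m, where 'a = 'a]] by (auto simp: n_def)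
    next
      fix Y :: "'a mat" assume Y: "Y \<in> {Y \<in> parabolic_nilradical (lam @ [m]). hook_type (Suc k) Y}"
      then have "Y \<in> (\<lambda>(X, B). bordered_mat X B) ` (?U \<times> carrier_mat n m)"
        using bij_betw_imp_surj_on[OF parabolic_nilradical_append[of lam m, where 'a = 'a]] by (simp add: n_def)
      then obtain p where p: "Y = (\<lambda>(X, B). bordered_mat X B) p" "p \<in> ?U \<times> carrier_mat n m"
        by (rule imageE)
      then obtain X B where XB: "X \<in> ?U" "B \<in> carrier_mat n m" "Y = bordered_mat X B" by (cases p) auto
      then have "(X, B) \<in> ?P" using Y by simp
      then show "Y \<in> (\<lambda>(X, B). bordered_mat X B) ` ?P" using XB(3) by (intro image_eqI[of _ _ "(X, B)"]) auto
    qed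
  qed (auto simp: n_def)
  then have "nilradical_hook_count TYPE('a) (Suc k) (lam @ [m]) = card ?P"
    unfolding nilradical_hook_count_def by (rule bij_betw_same_card[symmetric])
  also have "\<dots> = (\<Sum>X\<in>?U. card {B \<in> carrier_mat n m. hook_type (Suc k) (bordered_mat X B)})"
    by (rule card_SigmaI[OF finU]) (auto intro: finite_subset[OF _ finite_carrier_mat])
  finally have "real (nilradical_hook_count TYPE('a) (Suc k) (lam @ [m])) =
      (\<Sum>X\<in>?U. real (card {B \<in> carrier_mat n m. hook_type (Suc k) (bordered_mat X B)}))" by simp
  also have "\<dots> = (\<Sum>X\<in>?U. (if hook_type (Suc k) X then q ^ (Suc k * m) else 0) + (if hook_type k X then e else 0))"
  proof (rule sum.cong[OF refl])
    fix X assume X: "X \<in> ?U"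
    then have car: "X \<in> carrier_mat n n" by (auto simp: parabolic_nilradical_def n_def)
    \<comment> \<open>Strict upper triangularity supplies the nilpotency on which the count of
      borders rests.\<close>
    have "X ^\<^sub>m n = 0\<^sub>m n n"
      using car parabolic_nilradical_strictly_upper[OF X] by (intro strictly_upper_nilpotent) (auto simp: n_def)
    then show "real (card {B \<in> carrier_mat n m. hook_type (Suc k) (bordered_mat X B)}) =
       (if hook_type (Suc k) X then q ^ (Suc k * m) else 0) + (if hook_type k X then e else 0)"
      unfolding e_def q_def by (rule card_bordered_mat_hook_type[OF car])
  qed
  also have "\<dots> = q ^ (Suc k * m) * real (nilradical_hook_count TYPE('a) (Suc k) lam) +
      e * real (nilradical_hook_count TYPE('a) k lam)"
    using finU by (simp add: sum.distrib sum.If_cases nilradical_hook_count_def Int_def conj_commute)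
  finally show ?thesis unfolding e_def .
qed

text \<open>Only the zero matrix has a range with one element. In size 0 it fails the second
  condition, because there the identity is also the zero matrix.\<close>

lemma nilradical_hook_count_0:
  "nilradical_hook_count TYPE('a::{field,finite}) 0 lam = (if sum_list lam = 0 then 0 else 1)"
proof -
  let ?n = "sum_list lam"
  have "hook_type 0 X \<longleftrightarrow> X = 0\<^sub>m ?n ?n \<and> ?n \<noteq> 0" if "X \<in> parabolic_nilradical lam" for X :: "'a mat"
  proof -
    have X: "X \<in> carrier_mat ?n ?n" using that by (auto simp: parabolic_nilradical_def)
    have "1\<^sub>m ?n = (0\<^sub>m ?n ?n :: 'a mat) \<longleftrightarrow> ?n = 0"
    proof
      assume "1\<^sub>m ?n = (0\<^sub>m ?n ?n :: 'a mat)"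
      then have "1\<^sub>m ?n $$ (0, 0) = (0\<^sub>m ?n ?n :: 'a mat) $$ (0, 0)" by simp
      then show "?n = 0" by (cases "?n = 0") auto
    next
      have "1\<^sub>m 0 = (0\<^sub>m 0 0 :: 'a mat)" by (intro eq_matI) auto
      then show "?n = 0 \<Longrightarrow> 1\<^sub>m ?n = (0\<^sub>m ?n ?n :: 'a mat)" by metis
    qed
    then show ?thesis using mat_eq_0_iff_card_range[OF X] X by (auto simp: hook_type_def)
  qed
  then have "{X \<in> (parabolic_nilradical lam :: 'a mat set). hook_type 0 X} = 
      {X \<in> parabolic_nilradical lam. X = 0\<^sub>m ?n ?n \<and> ?n \<noteq> 0}"
    by blast
  also have "\<dots> = (if ?n = 0 then {} else {0\<^sub>m ?n ?n})"
    by (auto simp: parabolic_nilradical_def)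
  finally show ?thesis by (simp add: nilradical_hook_count_def)
qed

lemma nilradical_hook_count_Nil: "nilradical_hook_count TYPE('a::{field,finite}) k [] = 0"
proof -
  have "\<not> hook_type k X" if "X \<in> parabolic_nilradical []" for X :: "'a mat"
  proof -
    have "X ^\<^sub>m k = 0\<^sub>m 0 0" using that by (intro eq_matI) (auto simp: parabolic_nilradical_def)
    then show ?thesis using that by (auto simp: parabolic_nilradical_def hook_type_def)
  qed
  then have "{X \<in> parabolic_nilradical []. hook_type k (X :: 'a mat)} = {}" by blast
  then show ?thesis by (simp only: nilradical_hook_count_def card.empty)
qed

section \<open>Jordan types of hook shape\<close>

text \<open>From A = P B Q the range of \<open>A\<close> lies in the image of the range of
  \<open>B\<close> under \<open>P\<close>, and an image cannot be larger than its source; symmetry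
  of similarity gives the other inequality.\<close>

lemma card_range_similar:
  assumes "similar_mat (A :: 'a::{field,finite} mat) B"
  shows "card (mat_range A) = card (mat_range B)"
proof -
  have le: "card (mat_range A) \<le> card (mat_range B)" if sim: "similar_mat A B" for A B :: "'a mat"
  proof -
    obtain P Q where w: "similar_mat_wit A B P Q" using sim by (auto simp: similar_mat_def)
    define n where "n = dim_row A"
    note A = similar_mat_witD(3)[OF n_def w] and c = similar_mat_witD(4-7)[OF n_def w]
    have fin: "finite (mat_range B)" using vec_subspace_mat_range[OF c(2)] vec_subspace_finite by blast
    have "mat_range Q \<subseteq> carrier_vec n" using vec_subspaceD(1)[OF vec_subspace_mat_range[OF c(4)]] .
    moreover have "mat_range A = (*\<^sub>v) P ` (*\<^sub>v) B ` mat_range Q"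
      using mat_range_mult[of "P * B" n n Q n] mat_range_mult[of B n n Q n] mat_range_mult[OF c(3), of "B * Q" n] c
      by (simp add: A assoc_mult_mat[of P n n B n Q n])
    ultimately have "mat_range A \<subseteq> (*\<^sub>v) P ` mat_range B" using c by (auto simp: mat_range_def)
    then have "card (mat_range A) \<le> card ((*\<^sub>v) P ` mat_range B)" using fin by (intro card_mono) auto
    also have "\<dots> \<le> card (mat_range B)" using fin by (rule card_image_le)
    finally show ?thesis .
  qed
  show ?thesis using le[OF assms] le[OF similar_mat_sym[OF assms]] by simp
qed

lemma pow_eq_0_similar:
  assumes "similar_mat A B" "B ^\<^sub>m k = 0\<^sub>m (dim_row B) (dim_row B)"
  shows "A ^\<^sub>m k = 0\<^sub>m (dim_row A) (dim_row A)"
proof -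
  obtain P Q where w: "similar_mat_wit A B P Q" using assms(1) by (auto simp: similar_mat_def)
  define n where "n = dim_row A"
  note c = similar_mat_witD(4-7)[OF n_def w]
  have "B ^\<^sub>m k = 0\<^sub>m n n" using assms(2) c(2) by simp
  then have "A ^\<^sub>m k = P * 0\<^sub>m n n * Q" using similar_mat_wit_pow_id[OF w, of k] by simp
  then show ?thesis using c unfolding n_def[symmetric] by simp
qed

lemma hook_type_similar:
  assumes "similar_mat (A :: 'a::{field,finite} mat) B"
  shows "hook_type k A \<longleftrightarrow> hook_type k B"
  using card_range_similar[OF assms] pow_eq_0_similar[OF assms] pow_eq_0_similar[OF similar_mat_sym[OF assms]]
  by (auto simp: hook_type_def)

lemma card_range_block_diag:
  assumes A: "(A :: 'a::{field,finite} mat) \<in> carrier_mat n n" and D: "D \<in> carrier_mat m m"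
  shows "card (mat_range (four_block_mat A (0\<^sub>m n m) (0\<^sub>m m n) D)) = card (mat_range A) * card (mat_range D)"
proof -
  let ?F = "four_block_mat A (0\<^sub>m n m) (0\<^sub>m m n) D"
  have F: "?F \<in> carrier_mat (n + m) (n + m)" using A D by auto
  have "mat_range ?F = (\<lambda>(x, y). x @\<^sub>v y) ` (mat_range A \<times> mat_range D)"
  proof (intro equalityI subsetI)
    fix z assume "z \<in> mat_range ?F"
    then obtain v where v: "v \<in> carrier_vec (n + m)" "z = ?F *\<^sub>v v"
      unfolding mat_range_def carrier_matD(2)[OF F] by blast
    have "z = (A *\<^sub>v vec_first v n) @\<^sub>v (D *\<^sub>v vec_last v m)"
      using mult_mat_vec_split[OF A D, of "vec_first v n" "vec_last v m"] v by simp
    then show "z \<in> (\<lambda>(x, y). x @\<^sub>v y) ` (mat_range A \<times> mat_range D)"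
      using A D by (auto simp: mat_range_def)
  next
    fix z assume "z \<in> (\<lambda>(x, y). x @\<^sub>v y) ` (mat_range A \<times> mat_range D)"
    then obtain v w where "v \<in> carrier_vec n" "w \<in> carrier_vec m" "z = (A *\<^sub>v v) @\<^sub>v (D *\<^sub>v w)"
      unfolding mat_range_def carrier_matD(2)[OF A] carrier_matD(2)[OF D] by auto
    then have "z = ?F *\<^sub>v (v @\<^sub>v w)" "v @\<^sub>v w \<in> carrier_vec (n + m)"
      using mult_mat_vec_split[OF A D] by auto
    then show "z \<in> mat_range ?F" unfolding mat_range_def carrier_matD(2)[OF F] by blast
  qed
  moreover have "inj_on (\<lambda>(x, y). x @\<^sub>v y) (mat_range A \<times> mat_range D)"
  proof (rule inj_onI, clarify)
    fix x y x' y' assume "x \<in> mat_range A" "x' \<in> mat_range A" and eq: "x @\<^sub>v y = x' @\<^sub>v y'"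
    then have "x \<in> carrier_vec n" "x' \<in> carrier_vec n"
      using vec_subspaceD(1)[OF vec_subspace_mat_range[OF A]] by auto
    from append_vec_eq[OF this] eq show "x = x' \<and> y = y'" by simp
  qed
  ultimately show ?thesis by (simp add: card_image card_cartesian_product)
qed

text \<open>The block shifts coordinates by one place, so its kernel is the line of the first
  coordinate; \<open>rank_nullity_card\<close> does the rest.\<close>

lemma card_range_jordan_block_0:
  assumes "0 < m"
  shows "card (mat_range (jordan_block m (0 :: 'a::{field,finite}))) = CARD('a) ^ (m - 1)"
proof -
  let ?J = "jordan_block m (0 :: 'a)"
  have J: "?J \<in> carrier_mat m m" by simp
  have ent: "(?J *\<^sub>v v) $ i = (if Suc i < m then v $ Suc i else 0)" if "i < m" "v \<in> carrier_vec m" for i v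
  proof -
    have "(?J *\<^sub>v v) $ i = (\<Sum>j\<in>{0..<m}. row ?J i $ j * v $ j)"
      using that by (simp add: scalar_prod_def)
    also have "\<dots> = (\<Sum>j\<in>{0..<m}. (if Suc i = j then v $ j else 0))"
      by (rule sum.cong) (use that in auto)
    finally show ?thesis by simp
  qed
  have "mat_null ?J = (\<lambda>c. vec m (\<lambda>i. if i = 0 then c else 0)) ` UNIV"
  proof (intro equalityI subsetI)
    fix v assume v: "v \<in> mat_null ?J"
    then have vm: "v \<in> carrier_vec m" and Jv: "?J *\<^sub>v v = 0\<^sub>v m" by (auto simp: mat_null_def)
    have "v $ Suc i = 0" if "Suc i < m" for i
      using ent[of i v] that vm Jv by simp
    then have "v = vec m (\<lambda>i. if i = 0 then v $ 0 else 0)"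
      using vm by (intro eq_vecI) (auto simp: gr0_conv_Suc)
    then show "v \<in> (\<lambda>c. vec m (\<lambda>i. if i = 0 then c else 0)) ` UNIV" by blast
  next
    fix v :: "'a vec" assume "v \<in> (\<lambda>c. vec m (\<lambda>i. if i = 0 then c else 0)) ` UNIV"
    then obtain c where v: "v = vec m (\<lambda>i. if i = 0 then c else 0)" by blast
    then have "?J *\<^sub>v v = 0\<^sub>v m" using ent[of _ v] by (intro eq_vecI) auto
    then show "v \<in> mat_null ?J" using v by (simp add: mat_null_def)
  qed
  moreover have "inj (\<lambda>c :: 'a. vec m (\<lambda>i. if i = 0 then c else 0))"
  proof (rule injI)
    fix c d :: 'a assume "vec m (\<lambda>i. if i = 0 then c else 0) = vec m (\<lambda>i. if i = 0 then d else 0)"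
    then have "vec m (\<lambda>i. if i = 0 then c else 0) $ 0 = vec m (\<lambda>i. if i = 0 then d else 0) $ 0" by simp
    then show "c = d" using assms by simp
  qed
  ultimately have "card (mat_null ?J) = CARD('a)" by (simp add: card_image)
  then have "card (mat_range ?J) * CARD('a) = CARD('a) ^ (m - 1) * CARD('a)"
    using rank_nullity_card[OF J] assms by (cases m) (simp_all add: mult.commute)
  then show ?thesis by simp
qed

lemma nilpotent_jordan_Cons:
  "nilpotent_jordan (m # ns) = four_block_mat (jordan_block m 0) (0\<^sub>m m (sum_list ns))
     (0\<^sub>m (sum_list ns) m) (nilpotent_jordan ns)"
  by (simp add: nilpotent_jordan_def jordan_matrix_Cons o_def)

lemma nilpotent_jordan_carrier:
  "nilpotent_jordan ns \<in> carrier_mat (sum_list ns) (sum_list ns)"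
  by (rule carrier_matI) (simp_all add: nilpotent_jordan_def o_def)

lemma card_range_nilpotent_jordan:
  assumes "\<forall>m\<in>set ns. 0 < m"
  shows "card (mat_range (nilpotent_jordan ns :: 'a::{field,finite} mat)) = CARD('a) ^ (\<Sum>m\<leftarrow>ns. m - 1)"
  using assms
proof (induction ns)
  case Nil
  have "nilpotent_jordan [] = (0\<^sub>m 0 0 :: 'a mat)"
    using nilpotent_jordan_carrier[of "[]"] by (intro eq_matI) auto
  then show ?case using mat_eq_0_iff_card_range[of "nilpotent_jordan [] :: 'a mat" 0 0] by simp
next
  case (Cons m ns)
  then obtain l where "m = Suc l" by (cases m) auto
  with Cons show ?case
    unfolding nilpotent_jordan_Cons
    by (subst card_range_block_diag[OF _ nilpotent_jordan_carrier])
      (simp_all add: card_range_jordan_block_0 power_add)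
qed

lemma block_diag_eq_0_iff:
  assumes A: "A \<in> carrier_mat n n" and D: "D \<in> carrier_mat m m"
  shows "four_block_mat A (0\<^sub>m n m) (0\<^sub>m m n) D = 0\<^sub>m (n + m) (n + m) \<longleftrightarrow> A = 0\<^sub>m n n \<and> D = 0\<^sub>m m m"
proof
  assume eq: "four_block_mat A (0\<^sub>m n m) (0\<^sub>m m n) D = 0\<^sub>m (n + m) (n + m)"
  have ent: "four_block_mat A (0\<^sub>m n m) (0\<^sub>m m n) D $$ (i, j) = 0" if "i < n + m" "j < n + m" for i j
    unfolding eq using that by simp
  have "A $$ (i, j) = 0" if "i < n" "j < n" for i j using ent[of i j] A D that by simp
  moreover have "D $$ (i, j) = 0" if "i < m" "j < m" for i j using ent[of "n + i" "n + j"] A D that by simp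
  ultimately show "A = 0\<^sub>m n n \<and> D = 0\<^sub>m m m" using A D by (auto intro!: eq_matI)
qed auto

lemma nilpotent_jordan_pow_eq_0_iff:
  "nilpotent_jordan ns ^\<^sub>m k = (0\<^sub>m (sum_list ns) (sum_list ns) :: 'a::field mat) \<longleftrightarrow> (\<forall>m\<in>set ns. m \<le> k)"
proof (induction ns)
  case Nil
  show ?case
    using pow_carrier_mat[OF nilpotent_jordan_carrier[of "[]", where 'a = 'a], of k] by (auto intro!: eq_matI)
next
  case (Cons m ns)
  let ?s = "sum_list ns" and ?J = "jordan_block m (0 :: 'a) ^\<^sub>m k" and ?N = "nilpotent_jordan ns ^\<^sub>m k :: 'a mat"
  have J: "?J \<in> carrier_mat m m" and N: "?N \<in> carrier_mat ?s ?s"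
    using nilpotent_jordan_carrier[of ns, where 'a = 'a] by auto
  have "nilpotent_jordan (m # ns) ^\<^sub>m k = four_block_mat ?J (0\<^sub>m m ?s) (0\<^sub>m ?s m) ?N"
    unfolding nilpotent_jordan_Cons by (rule pow_four_block_mat[OF _ nilpotent_jordan_carrier]) simp
  moreover have "four_block_mat ?J (0\<^sub>m m ?s) (0\<^sub>m ?s m) ?N = 0\<^sub>m (m + ?s) (m + ?s) \<longleftrightarrow> ?J = 0\<^sub>m m m \<and> ?N = 0\<^sub>m ?s ?s"
    by (rule block_diag_eq_0_iff[OF J N])
  moreover have "?J = 0\<^sub>m m m \<longleftrightarrow> m \<le> k"
  proof
    assume eq: "?J = 0\<^sub>m m m"
    show "m \<le> k"
    proof (rule ccontr)
      assume "\<not> m \<le> k"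
      \<comment> \<open>Powers of the block move its diagonal of ones to the right; row 0 is the
        last to lose its entry.\<close>
      then have "?J $$ (0, k) = 1" by (simp add: jordan_block_zero_pow)
      with eq \<open>\<not> m \<le> k\<close> show False by simp
    qed
  qed (auto simp: jordan_block_zero_pow intro!: eq_matI)
  ultimately show ?case using Cons by simp
qed

lemma hook_type_nilpotent_jordan:
  assumes "\<forall>m\<in>set ns. 0 < m"
  shows "hook_type k (nilpotent_jordan ns :: 'a::{field,finite} mat) \<longleftrightarrow>
    (\<Sum>m\<leftarrow>ns. m - 1) = k \<and> (\<exists>m\<in>set ns. k < m)"
proof -
  have "CARD('a) ^ (\<Sum>m\<leftarrow>ns. m - 1) = CARD('a) ^ k \<longleftrightarrow> (\<Sum>m\<leftarrow>ns. m - 1) = k"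
    using field_card_ge_2[where 'a = 'a] by (intro power_inject_exp) simp
  then show ?thesis
    using nilpotent_jordan_carrier[of ns, where 'a = 'a]
    by (auto simp: hook_type_def card_range_nilpotent_jordan[OF assms] nilpotent_jordan_pow_eq_0_iff not_le)
qed

text \<open>Conjugation by the block permutation matrix that exchanges the two summands.\<close>

lemma similar_block_diag_swap:
  assumes A: "(A :: 'a::field mat) \<in> carrier_mat n n" and D: "D \<in> carrier_mat m m"
  shows "similar_mat (four_block_mat A (0\<^sub>m n m) (0\<^sub>m m n) D) (four_block_mat D (0\<^sub>m m n) (0\<^sub>m n m) A)"
proof (rule similar_matI)
  let ?P = "four_block_mat (0\<^sub>m n m) (1\<^sub>m n) (1\<^sub>m m) (0\<^sub>m m n) :: 'a mat"
  let ?Q = "four_block_mat (0\<^sub>m m n) (1\<^sub>m m) (1\<^sub>m n) (0\<^sub>m n m) :: 'a mat"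
  let ?F = "four_block_mat A (0\<^sub>m n m) (0\<^sub>m m n) D" and ?G = "four_block_mat D (0\<^sub>m m n) (0\<^sub>m n m) A"
  have "?P \<in> carrier_mat (n + m) (m + n)" "?Q \<in> carrier_mat (m + n) (n + m)"
    "?F \<in> carrier_mat (n + m) (n + m)" "?G \<in> carrier_mat (m + n) (m + n)"
    using A D by auto
  then show "{?F, ?G, ?P, ?Q} \<subseteq> carrier_mat (n + m) (n + m)" by (simp add: add.commute)
  show "?P * ?Q = 1\<^sub>m (n + m)"
    by (subst mult_four_block_mat[of _ n m _ n _ m _ _ n _ m]) auto
  show "?Q * ?P = 1\<^sub>m (n + m)"
    by (subst mult_four_block_mat[of _ m n _ m _ n _ _ m _ n]) (auto simp: add.commute)
  have "?P * ?G = four_block_mat (0\<^sub>m n m) A D (0\<^sub>m m n)"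
    using A D by (subst mult_four_block_mat[of _ n m _ n _ m _ _ m _ n]) auto
  then show "?F = ?P * ?G * ?Q"
    using A D by (simp add: mult_four_block_mat[of _ n m _ n _ m _ _ n _ m])
qed

lemma nilpotent_jordan_append:
  "nilpotent_jordan (as @ bs) = four_block_mat (nilpotent_jordan as) (0\<^sub>m (sum_list as) (sum_list bs))
     (0\<^sub>m (sum_list bs) (sum_list as)) (nilpotent_jordan bs :: 'a::field mat)"
proof -
  let ?A = "nilpotent_jordan as :: 'a mat" and ?B = "nilpotent_jordan bs :: 'a mat"
  have "nilpotent_jordan (as @ bs) = four_block_mat ?A (0\<^sub>m (dim_row ?A) (dim_col ?B)) (0\<^sub>m (dim_row ?B) (dim_col ?A)) ?B"
    by (simp only: nilpotent_jordan_def jordan_matrix_def map_append diag_block_mat_append Let_def)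
  then show ?thesis by (simp add: carrier_matD[OF nilpotent_jordan_carrier])
qed

text \<open>A Jordan form may list its blocks in any order. For a hook a rotation is enough to bring
  the long block to the front, because all other blocks have size 1.\<close>

lemma similar_nilpotent_jordan_rotate:
  "similar_mat (nilpotent_jordan (as @ bs) :: 'a::field mat) (nilpotent_jordan (bs @ as))"
  unfolding nilpotent_jordan_append
  by (rule similar_block_diag_swap[OF nilpotent_jordan_carrier nilpotent_jordan_carrier])

text \<open>A part m > k contributes m - 1, hence at least k, to a sum equal to k. So it is k+1 and
  the other parts contribute 0, which makes them 1.\<close>

lemma hook_parts_replicate:
  fixes ns :: "nat list"
  assumes "\<forall>m\<in>set ns. 0 < m" "(\<Sum>m\<leftarrow>ns. m - 1) = k" "m \<in> set ns" "k < m"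
  obtains a b where "ns = replicate a 1 @ (k + 1) # replicate b 1"
proof -
  obtain as bs where ns: "ns = as @ m # bs" using split_list[OF assms(3)] by blast
  have "(\<Sum>m\<leftarrow>as. m - 1) + (m - 1) + (\<Sum>m\<leftarrow>bs. m - 1) = k" using assms(2) ns by (simp add: add.assoc)
  moreover have "x = 0 \<and> y = 0 \<and> m = k + 1" if "x + (m - 1) + y = k" for x y
    using that assms(4) by (cases m) auto
  ultimately have z: "(\<Sum>m\<leftarrow>as. m - 1) = 0" "(\<Sum>m\<leftarrow>bs. m - 1) = 0" "m = k + 1" by blast+
  have one: "x = 1" if "x \<in> set as \<union> set bs" for x
  proof -
    have "x - 1 = 0" using that z(1,2) by auto
    moreover have "0 < x" using that assms(1) ns by auto
    ultimately show ?thesis by simp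
  qed
  then have "as = replicate (length as) 1" "bs = replicate (length bs) 1"
    by (auto intro!: replicate_eqI)
  then show thesis using that ns z(3) by metis
qed

text \<open>Triangular matrices have a Jordan form over every field; it remains to see that all its
  eigenvalues are 0.\<close>

lemma strictly_upper_jordan:
  assumes X: "(X :: 'a::field mat) \<in> carrier_mat n n"
    and su: "\<And>i j. i < n \<Longrightarrow> j < n \<Longrightarrow> j \<le> i \<Longrightarrow> X $$ (i, j) = 0"
  obtains ns where "\<forall>m\<in>set ns. 0 < m" "similar_mat X (nilpotent_jordan ns)"
proof -
  have ut: "upper_triangular X" using X su by (intro upper_triangularI) auto
  define as where "as = triangular_to_jnf_vector X"
  have jnf: "jordan_nf X as" unfolding as_def by (rule triangular_to_jnf_vector[OF X ut])
  \<comment> \<open>The characteristic polynomial is evaluated at the eigenvalue \<open>a\<close> in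
    two ways: the Jordan form gives 0, and the zero diagonal gives a power of
    \<open>a\<close>.\<close>
  have zero: "a = 0" if "(m, a) \<in> set as" for m a
  proof -
    have poly_lin: "poly (\<Prod>b\<leftarrow>xs. [:- b, 1:]) a = (\<Prod>b\<leftarrow>xs. a - b)" for xs
      by (induction xs) (auto simp: algebra_simps)
    have prod_zeros: "set xs \<subseteq> {0} \<Longrightarrow> (\<Prod>b\<leftarrow>xs. a - b) = a ^ length xs" for xs
      by (induction xs) auto
    have "m \<noteq> 0" using jnf that by (force simp: jordan_nf_def)
    have "poly (char_poly X) a = (\<Prod>(n, b)\<leftarrow>as. (a - b) ^ n)"
      unfolding jordan_nf_char_poly[OF jnf] by (induction as) auto
    moreover have "(\<lambda>(n, b). (a - b) ^ n) (m, a) \<in> (\<lambda>(n, b). (a - b) ^ n) ` set as"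
      using that by (rule imageI)
    then have "0 \<in> set (map (\<lambda>(n, b). (a - b) ^ n) as)" using \<open>m \<noteq> 0\<close> by (simp add: zero_power)
    then have "(\<Prod>(n, b)\<leftarrow>as. (a - b) ^ n) = 0" by (simp add: prod_list_zero_iff)
    moreover have "poly (char_poly X) a = (\<Prod>b\<leftarrow>diag_mat X. a - b)"
      unfolding char_poly_upper_triangular[OF X ut] by (rule poly_lin)
    moreover have "set (diag_mat X) \<subseteq> {0}" using X su by (auto simp: diag_mat_def)
    then have "(\<Prod>b\<leftarrow>diag_mat X. a - b) = a ^ length (diag_mat X)" by (rule prod_zeros)
    ultimately show "a = 0" by simp
  qed
  then have as: "as = map (\<lambda>m. (m, 0)) (map fst as)"
    by (intro nth_equalityI) (auto simp: prod_eq_iff in_set_conv_nth)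
  show thesis
  proof (rule that[of "map fst as"])
    show "\<forall>m\<in>set (map fst as). 0 < m" using jnf by (auto simp: jordan_nf_def intro: gr0I)
    show "similar_mat X (nilpotent_jordan (map fst as))"
      using jnf as unfolding nilpotent_jordan_def jordan_nf_def by metis
  qed
qed

text \<open>\<open>hook_type\<close> is invariant under similarity and holds of the hook.
  Conversely, it forces the block sizes of a Jordan form to be a hook up to rotation, and comparing
  matrix sizes fixes the number of parts equal to 1.\<close>

lemma nilpotent_class_hook_iff:
  assumes X: "(X :: 'a::{field,finite} mat) \<in> carrier_mat n n"
    and su: "\<And>i j. i < n \<Longrightarrow> j < n \<Longrightarrow> j \<le> i \<Longrightarrow> X $$ (i, j) = 0"
    and k: "0 < k" "k < n"
  shows "X \<in> nilpotent_class ((k + 1) # replicate (n - k - 1) 1) \<longleftrightarrow> hook_type k X"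
proof
  assume "X \<in> nilpotent_class ((k + 1) # replicate (n - k - 1) 1)"
  then have "similar_mat X (nilpotent_jordan ((k + 1) # replicate (n - k - 1) 1))" by (simp add: nilpotent_class_def)
  moreover have "hook_type k (nilpotent_jordan ((k + 1) # replicate (n - k - 1) 1) :: 'a mat)"
    by (subst hook_type_nilpotent_jordan) (auto simp: sum_list_replicate)
  ultimately show "hook_type k X" by (simp add: hook_type_similar)
next
  assume h: "hook_type k X"
  obtain ns where ns: "\<forall>m\<in>set ns. 0 < m" and sim: "similar_mat X (nilpotent_jordan ns)"
    using strictly_upper_jordan[OF X su] by blast
  then have "(\<Sum>m\<leftarrow>ns. m - 1) = k" "\<exists>m\<in>set ns. k < m"
    using h hook_type_similar[OF sim] hook_type_nilpotent_jordan[OF ns, where 'a = 'a] by auto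
  then obtain a b where ab: "ns = replicate a 1 @ (k + 1) # replicate b 1"
    using hook_parts_replicate[OF ns] by metis
  have "sum_list ns = n"
    using similar_matD[OF sim] X nilpotent_jordan_carrier[of ns, where 'a = 'a]
    by (metis carrier_matD(1) insert_subset)
  then have "b + a = n - k - 1" by (simp add: ab sum_list_replicate)
  then have "((k + 1) # replicate b 1) @ replicate a 1 = (k + 1) # replicate (n - k - 1) (1 :: nat)"
    by (simp flip: replicate_add)
  then have "similar_mat X (nilpotent_jordan ((k + 1) # replicate (n - k - 1) 1))"
    using similar_mat_trans[OF sim] similar_nilpotent_jordan_rotate unfolding ab by metis
  then show "X \<in> nilpotent_class ((k + 1) # replicate (n - k - 1) 1)" by (simp add: nilpotent_class_def)
qed

lemma F_count_hook:
  assumes "0 < k" "k < sum_list lam"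
  shows "F_count TYPE('a::{field,finite}) ((k + 1) # replicate (sum_list lam - k - 1) 1) lam =
    nilradical_hook_count TYPE('a) k lam"
proof -
  have "X \<in> nilpotent_class ((k + 1) # replicate (sum_list lam - k - 1) 1) \<longleftrightarrow> hook_type k X"
    if X: "X \<in> parabolic_nilradical lam" for X :: "'a mat"
    using X parabolic_nilradical_strictly_upper[OF X]
    by (intro nilpotent_class_hook_iff assms) (auto simp: parabolic_nilradical_def)
  then show ?thesis
    unfolding F_count_def nilradical_hook_count_def by (intro arg_cong[of _ _ card]) auto
qed

section \<open>The sum over subsets\<close>

lemma q_bracket_inverse:
  assumes "1 < (q :: real)"
  shows "q_bracket (1 / q) m = q * (q ^ m - 1) / (q ^ m * (q - 1))"
proof -
  have "q_bracket (1 / q) m = ((1 - q ^ m) / q ^ m) / ((1 - q) / q)"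
    using assms by (simp add: q_bracket_def diff_divide_distrib power_one_over)
  also have "\<dots> = q * (1 - q ^ m) / (q ^ m * (1 - q))"
    using assms by (simp add: mult_ac)
  also have "\<dots> = - (q * (q ^ m - 1)) / - (q ^ m * (q - 1))"
    by (rule arg_cong2[of _ _ _ _ "(/)"]) (simp_all add: algebra_simps)
  finally show ?thesis by simp
qed

text \<open>The double sum of the theorem flattened to one sum over subsets, so that a last index
  can be split off. The shift in \<open>lam ! (i - 1)\<close> comes from subsets of indices that
  start at 1.\<close>

definition bracket_sum :: "real \<Rightarrow> nat \<Rightarrow> nat list \<Rightarrow> real" where
  "bracket_sum x k lam = (\<Sum>A | A \<subseteq> {2..length lam} \<and> card A = k.
     q_bracket x (\<Sum>i = 1..Min A - 1. lam ! (i - 1)) * (\<Prod>i\<in>A. q_bracket x (lam ! (i - 1))))"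

lemma bracket_sum_short:
  assumes "length lam \<le> 1" "0 < k"
  shows "bracket_sum x k lam = 0"
proof -
  have "{A. A \<subseteq> {2..length lam} \<and> card A = k} = {}" using assms by auto
  then show ?thesis unfolding bracket_sum_def by (simp only: sum.empty)
qed

text \<open>Groups the subsets by their minimum. The k elements of \<open>A\<close> lie between
  \<open>Min A\<close> and the length s, whence the upper limit s - k + 1.\<close>

lemma bracket_sum_by_min:
  assumes "0 < k"
  shows "bracket_sum x k lam =
    (\<Sum>j = 2..length lam - k + 1. q_bracket x (\<Sum>i = 1..j - 1. lam ! (i - 1)) *
       (\<Sum>A | A \<subseteq> {2..length lam} \<and> card A = k \<and> Min A = j. \<Prod>i\<in>A. q_bracket x (lam ! (i - 1))))"
proof -
  let ?S = "{A. A \<subseteq> {2..length lam} \<and> card A = k}"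
  have fin: "finite ?S" by (rule finite_subset[of _ "Pow {2..length lam}"]) auto
  have "Min ` ?S \<subseteq> {2..length lam - k + 1}"
  proof clarify
    fix A assume A: "A \<subseteq> {2..length lam}" "k = card A"
    then have fA: "finite A" "A \<noteq> {}" using assms finite_subset by auto
    then have "Min A \<in> {2..length lam}" using A Min_in by blast
    moreover have "A \<subseteq> {Min A..length lam}" using A fA by auto
    then have "card A \<le> card {Min A..length lam}" by (intro card_mono) auto
    ultimately show "Min A \<in> {2..length lam - card A + 1}" by auto
  qed
  note group = sum.group[OF fin finite_atLeastAtMost this, symmetric]
  have "bracket_sum x k lam = (\<Sum>j = 2..length lam - k + 1. \<Sum>A | A \<in> ?S \<and> Min A = j.
      q_bracket x (\<Sum>i = 1..Min A - 1. lam ! (i - 1)) * (\<Prod>i\<in>A. q_bracket x (lam ! (i - 1))))"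
    unfolding bracket_sum_def by (rule group)
  also have "\<dots> = (\<Sum>j = 2..length lam - k + 1. q_bracket x (\<Sum>i = 1..j - 1. lam ! (i - 1)) *
       (\<Sum>A | A \<subseteq> {2..length lam} \<and> card A = k \<and> Min A = j. \<Prod>i\<in>A. q_bracket x (lam ! (i - 1))))"
    unfolding sum_distrib_left by (intro sum.cong) auto
  finally show ?thesis .
qed

lemma sum_nth_prefix:
  "l \<le> length lam \<Longrightarrow> (\<Sum>i = 1..l. lam ! (i - 1)) = sum_list (take l lam)"
  by (induction l) (auto simp: take_Suc_conv_app_nth)

text \<open>Removing the last index from a subset keeps the minimum unless the subset was a
  singleton. In that case the prefix factor becomes the bracket of the whole of
  \<open>sum_list lam\<close>; this term takes the place of \<open>bracket_sum x 0 lam\<close>,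
  which would refer to \<open>Min {}\<close>.\<close>

lemma bracket_sum_append:
  "bracket_sum x (Suc k) (lam @ [m]) = bracket_sum x (Suc k) lam +
     q_bracket x m * (if k = 0 then q_bracket x (sum_list lam) else bracket_sum x k lam)"
proof (cases "lam = []")
  case True
  \<comment> \<open>The new index is 1, which is outside the range starting at 2; on the right the
    bracket of 0 vanishes.\<close>
  then show ?thesis by (simp add: q_bracket_def bracket_sum_short)
next
  case False
  let ?s = "length lam" and ?l = "lam @ [m]"
  define f where "f lam A = q_bracket x (\<Sum>i = 1..Min A - 1. lam ! (i - 1)) * (\<Prod>i\<in>A. q_bracket x (lam ! (i - 1)))"
    for lam A
  have bracket_sum: "bracket_sum x k lam = (\<Sum>A\<in>{A. A \<subseteq> {2..length lam} \<and> card A = k}. f lam A)" for k lam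
    by (simp only: bracket_sum_def f_def)
  let ?S = "\<lambda>(s :: nat) k. {A. A \<subseteq> {2..s} \<and> card A = k}"
  have fin: "finite (?S s k)" for s k by (rule finite_subset[of _ "Pow {2..s}"]) auto
  have Suc_notin: "Suc ?s \<notin> A" if "A \<subseteq> {2..?s}" for A using that by auto
  have finA: "finite A" if "A \<subseteq> {2..?s}" for A using that by (rule finite_subset) simp
  have "?S (Suc ?s) (Suc k) = ?S ?s (Suc k) \<union> insert (Suc ?s) ` ?S ?s k"
  proof (intro equalityI subsetI)
    fix A assume A: "A \<in> ?S (Suc ?s) (Suc k)"
    show "A \<in> ?S ?s (Suc k) \<union> insert (Suc ?s) ` ?S ?s k"
    proof (cases "Suc ?s \<in> A")
      case True
      then have "A = insert (Suc ?s) (A - {Suc ?s})" by blast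
      moreover have "A - {Suc ?s} \<in> ?S ?s k"
        using A True finite_subset[of A "{2..Suc ?s}"] by (auto simp: le_Suc_eq)
      ultimately show ?thesis by blast
    next
      case False
      then show ?thesis using A by (force simp: le_Suc_eq)
    qed
  next
    fix A assume "A \<in> ?S ?s (Suc k) \<union> insert (Suc ?s) ` ?S ?s k"
    then consider "A \<in> ?S ?s (Suc k)" | B where "A = insert (Suc ?s) B" "B \<in> ?S ?s k" by blast
    then show "A \<in> ?S (Suc ?s) (Suc k)"
    proof cases
      case 1
      then show ?thesis by (auto dest: subsetD)
    next
      case 2
      then have B: "B \<subseteq> {2..?s}" "card B = k" by auto
      moreover have "2 \<le> Suc ?s" using False by (cases lam) auto
      ultimately show ?thesis
        using card_insert_disjoint[OF finA Suc_notin, OF B(1) B(1)] by (auto simp: 2(1))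
    qed
  qed
  moreover have "?S ?s (Suc k) \<inter> insert (Suc ?s) ` ?S ?s k = {}" using Suc_notin by auto
  moreover have inj: "inj_on (insert (Suc ?s)) (?S ?s k)"
    using Suc_notin by (intro inj_onI) (metis (lifting) insert_ident mem_Collect_eq)
  ultimately have "bracket_sum x (Suc k) ?l = (\<Sum>A\<in>?S ?s (Suc k). f ?l A) + (\<Sum>A\<in>?S ?s k. f ?l (insert (Suc ?s) A))"
    unfolding bracket_sum using fin by (simp add: sum.union_disjoint sum.reindex)
  moreover have f_eq: "f ?l A = f lam A" if "A \<subseteq> {2..?s}" "A \<noteq> {}" for A
  proof -
    have nth: "?l ! (i - 1) = lam ! (i - 1)" if "i \<in> {1..?s}" for i
    proof -
      have "i - 1 < ?s" using that by auto
      then show ?thesis by (simp add: nth_append)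
    qed
    have "Min A \<in> A" using that finA by simp
    then have "Min A \<in> {2..?s}" using that(1) by blast
    then have "{1..Min A - 1} \<subseteq> {1..?s}" "A \<subseteq> {1..?s}" using that(1) by force+
    then show ?thesis unfolding f_def using nth
      by (intro arg_cong2[of _ _ _ _ "(*)"] arg_cong[of _ _ "q_bracket x"] sum.cong prod.cong) blast+
  qed
  moreover have "(\<Sum>A\<in>?S ?s (Suc k). f ?l A) = bracket_sum x (Suc k) lam"
    unfolding bracket_sum
  proof (rule sum.cong[OF refl])
    fix A assume A: "A \<in> ?S ?s (Suc k)"
    then have "A \<noteq> {}" by auto
    with A show "f ?l A = f lam A" by (intro f_eq) auto
  qed
  moreover have "(\<Sum>A\<in>?S ?s k. f ?l (insert (Suc ?s) A)) =
      q_bracket x m * (if k = 0 then q_bracket x (sum_list lam) else bracket_sum x k lam)"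
  proof (cases "k = 0")
    case True
    have "?S ?s k = {{}}"
    proof (intro equalityI subsetI)
      fix A assume "A \<in> ?S ?s k"
      then show "A \<in> {{}}" using finA[of A] True by simp
    qed (use True in auto)
    moreover have "f ?l {Suc ?s} = q_bracket x m * q_bracket x (sum_list lam)"
      unfolding f_def using sum_nth_prefix[of ?s ?l] by (simp add: nth_append)
    ultimately show ?thesis using True by simp
  next
    case False
    have "f ?l (insert (Suc ?s) A) = q_bracket x m * f lam A" if A: "A \<in> ?S ?s k" for A
    proof -
      have ne: "A \<noteq> {}" using A False by auto
      have "Min A \<in> A" using A ne finA by simp
      then have "Min A \<le> Suc ?s" using A by auto
      then have "Min (insert (Suc ?s) A) = Min A"
        using Min_insert[OF finA ne, of "Suc ?s"] A by (simp add: min_absorb2)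
      then have "f ?l (insert (Suc ?s) A) = q_bracket x m * f ?l A"
        unfolding f_def using A finA[of A] Suc_notin[of A] by (simp add: nth_append)
      then show ?thesis using f_eq A ne by simp
    qed
    then show ?thesis using False by (simp add: bracket_sum sum_distrib_left)
  qed
  ultimately show ?thesis by simp
qed

section \<open>Solution of the recursion\<close>

lemma cancel_two_brackets:
  fixes q a b p x y :: real
  assumes "q \<noteq> 0" "p \<noteq> 0" "a \<noteq> 0" "b \<noteq> 0"
  shows "a * (p * b / q\<^sup>2) * (q * x / (a * p) * (q * y / (b * p))) = y * x / p"
  using assms by (simp add: field_simps power2_eq_square)

text \<open>Like \<open>cancel_two_brackets\<close>, the algebra of one rank increase with the
  powers of q replaced by variables, so that it is a plain field identity. The variable a stands for
  q^m, b for q^(l m), c for q^n, d for q^l, e for q^(l n), r for (q-1)^l and t for the accumulated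
  denominator.\<close>

lemma cancel_one_bracket:
  fixes q r a b c d e t :: real
  assumes "q \<noteq> 0" "q - 1 \<noteq> 0" "a \<noteq> 0" "d \<noteq> 0" "t \<noteq> 0"
  shows "(a * b) * ((q - 1) * r * (c * e) / (t * (d * q\<^sup>2))) * (q * (a - 1) / (a * (q - 1))) =
    (c / q) * (b * (a - 1)) / d * (r * e / t)"
  using assms by (simp add: divide_simps power2_eq_square)

text \<open>The exponents \<open>i + 2\<close> collect the powers of q lost when the rank rises from
  i to i+1. For positive i, one comes from the hyperplane, i from the size of the old range and one
  from writing q^m - 1 through the bracket at 1/q. For i = 0 the two brackets lose one each.\<close>

lemma nilradical_hook_count_eq:
  fixes lam :: "nat list"
  assumes "0 < k"
  defines "q \<equiv> real CARD('a::{field,finite})"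
  shows "real (nilradical_hook_count TYPE('a) k lam) =
    (q - 1) ^ k * q ^ (k * sum_list lam) / q ^ (\<Sum>i<k. i + 2) * bracket_sum (1 / q) k lam"
  using assms(1)
proof (induction lam arbitrary: k rule: rev_induct)
  case Nil
  then show ?case by (simp add: nilradical_hook_count_Nil bracket_sum_short)
next
  case (snoc m lam)
  let ?n = "sum_list lam" and ?T = "\<lambda>k. \<Sum>i<k. i + 2 :: nat"
  have q: "1 < q" using field_card_ge_2[where 'a = 'a] by (simp add: q_def)
  obtain l where k: "k = Suc l" using snoc.prems by (cases k) auto
  note rec = nilradical_hook_count_append[of l lam m, where 'a = 'a, folded q_def]
  \<comment> \<open>The prefactor for the shorter list; both terms of the recursion contain it times
    q^(k m).\<close>
  define c where "c = (q - 1) ^ k * q ^ (k * ?n) / q ^ ?T k"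
  have split: "(q - 1) ^ k * q ^ (k * sum_list (lam @ [m])) / q ^ ?T k = q ^ (k * m) * c"
    by (simp add: c_def distrib_left power_add)
  have first: "q ^ (Suc l * m) * real (nilradical_hook_count TYPE('a) (Suc l) lam) =
      q ^ (k * m) * c * bracket_sum (1 / q) k lam"
    using snoc.IH[OF snoc.prems] by (simp add: c_def k)
  have second: "(q ^ ?n - (if l = 0 then 1 else q ^ ?n / q)) * (q ^ (Suc l * m) - q ^ (l * m)) / (q ^ Suc l - q ^ l) *
      real (nilradical_hook_count TYPE('a) l lam) =
      q ^ (k * m) * c * (q_bracket (1 / q) m * (if l = 0 then q_bracket (1 / q) ?n else bracket_sum (1 / q) l lam))"
  proof (cases "l = 0")
    case True
    \<comment> \<open>The count of type 0 is 1 except in size 0, and there the factor q^n - 1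
      vanishes.\<close>
    have "(q ^ ?n - 1) * real (nilradical_hook_count TYPE('a) 0 lam) = q ^ ?n - 1"
      by (cases "?n = 0") (simp_all add: nilradical_hook_count_0 del: sum_list_eq_0_iff)
    moreover have "(q ^ ?n - 1) * (q ^ m - 1) / (q - 1) * real (nilradical_hook_count TYPE('a) 0 lam) =
       (q ^ ?n - 1) * real (nilradical_hook_count TYPE('a) 0 lam) * ((q ^ m - 1) / (q - 1))"
      by simp
    ultimately have "(q ^ ?n - 1) * (q ^ m - 1) / (q - 1) * real (nilradical_hook_count TYPE('a) 0 lam) =
       (q ^ ?n - 1) * (q ^ m - 1) / (q - 1)"
      by auto
    moreover have "q ^ m * ((q - 1) * q ^ ?n / q\<^sup>2) * (q * (q ^ m - 1) / (q ^ m * (q - 1)) * (q * (q ^ ?n - 1) / (q ^ ?n * (q - 1)))) =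
       (q ^ ?n - 1) * (q ^ m - 1) / (q - 1)"
      using q by (intro cancel_two_brackets) auto
    ultimately show ?thesis
      using True by (simp add: k c_def q_bracket_inverse[OF q] numeral_2_eq_2[symmetric])
  next
    case False
    define b where "b = bracket_sum (1 / q) l lam"
    have "q ^ (k * m) * c * q_bracket (1 / q) m =
        (q ^ ?n - q ^ ?n / q) * (q ^ (Suc l * m) - q ^ (l * m)) / (q ^ Suc l - q ^ l) *
        ((q - 1) ^ l * q ^ (l * ?n) / q ^ ?T l)"
    proof -
      have nz: "q \<noteq> 0" "q - 1 \<noteq> 0" "q ^ i \<noteq> 0" for i using q by auto
      have "q ^ (k * m) * c * q_bracket (1 / q) m =
         (q ^ m * q ^ (l * m)) * ((q - 1) * (q - 1) ^ l * (q ^ ?n * q ^ (l * ?n)) / (q ^ ?T l * (q ^ l * q\<^sup>2))) *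
         (q * (q ^ m - 1) / (q ^ m * (q - 1)))"
        by (simp add: k c_def q_bracket_inverse[OF q] power_add power2_eq_square mult_ac)
      also have "\<dots> = (q ^ ?n / q) * (q ^ (l * m) * (q ^ m - 1)) / q ^ l * ((q - 1) ^ l * q ^ (l * ?n) / q ^ ?T l)"
        using nz by (intro cancel_one_bracket) auto
      \<comment> \<open>Expanding the fraction by q - 1 restores the differences that occur in the
        recursion.\<close>
      also have "(q ^ ?n / q) * (q ^ (l * m) * (q ^ m - 1)) / q ^ l =
         ((q ^ ?n / q) * (q - 1)) * (q ^ (l * m) * (q ^ m - 1)) / (q ^ l * (q - 1))"
        using nz by simp
      also have "(q ^ ?n / q) * (q - 1) = q ^ ?n - q ^ ?n / q" using nz by (simp add: field_simps)
      also have "q ^ (l * m) * (q ^ m - 1) = q ^ (Suc l * m) - q ^ (l * m)" by (simp add: algebra_simps power_add)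
      also have "q ^ l * (q - 1) = q ^ Suc l - q ^ l" by (simp add: algebra_simps)
      finally show ?thesis .
    qed
    note bracket_m = this
    have IH: "real (nilradical_hook_count TYPE('a) l lam) = (q - 1) ^ l * q ^ (l * ?n) / q ^ ?T l * b"
      using snoc.IH[of l] False by (simp add: b_def)
    show ?thesis
      unfolding IH b_def[symmetric] if_not_P[OF False] mult.assoc[of _ _ b, symmetric]
      using bracket_m False by (simp only: if_False)
  qed
  show ?case
    unfolding split using rec first second
    by (simp add: k bracket_sum_append distrib_left)
qed

text \<open>Passing from k to k+1 adds n - k - 2 to both sides. Integers avoid truncated
  subtraction.\<close>

lemma hook_exponent:
  "k \<le> n \<Longrightarrow> int (n choose 2) - int ((n - k) choose 2) - int k = int (k * n) - int (\<Sum>i<k. i + 2)"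
proof (induction k)
  case (Suc k)
  then have "n - k = Suc (n - Suc k)" by simp
  then have "(n - k) choose 2 = ((n - Suc k) choose 2) + (n - Suc k)"
    by (simp add: numeral_2_eq_2)
  with Suc show ?case by (simp add: of_nat_diff)
qed simp

theorem theorem2p20:
  fixes lam mu :: "nat list" and n s k q :: nat
  assumes "q = card (UNIV :: 'a::{field,finite} set)"
    and "is_partition_of lam n"
    and "s = length lam"
    and "1 \<le> k" and "k \<le> s - 1"
    and "mu = (k + 1) # replicate (n - k - 1) 1"
  shows "real (F_count TYPE('a) mu lam) =
    (real q - 1) ^ k * real q powi (int (n choose 2) - int ((n - k) choose 2) - int k) *
    (\<Sum>j = 2..s - k + 1.
       q_bracket (1 / real q) (\<Sum>i = 1..j - 1. lam ! (i - 1)) *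
       (\<Sum>A | A \<subseteq> {2..s} \<and> card A = k \<and> Min A = j.
          \<Prod>i\<in>A. q_bracket (1 / real q) (lam ! (i - 1))))"
proof -
  have pos: "\<forall>x\<in>set lam. 0 < x" and n: "sum_list lam = n" using assms(2) by (auto simp: is_partition_of_def)
  \<comment> \<open>Positive parts make s at most n, so k < s ensures that a hook with first part
    k+1 has size n.\<close>
  have "length lam \<le> sum_list lam" using pos by (induction lam) auto
  then have kn: "k < n" using assms(3-5) n by linarith
  have k: "0 < k" using assms(4) by simp
  have q: "real q \<noteq> 0" using assms(1) by simp
  have "real (F_count TYPE('a) mu lam) = real (nilradical_hook_count TYPE('a) k lam)"
    using F_count_hook[of k lam, where 'a = 'a] k kn by (simp add: n assms(6))
  also have "\<dots> = (real q - 1) ^ k * (real q ^ (k * n) / real q ^ (\<Sum>i<k. i + 2)) * bracket_sum (1 / real q) k lam"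
    using nilradical_hook_count_eq[OF k, of lam, where 'a = 'a] by (simp add: n assms(1))
  also have "real q ^ (k * n) / real q ^ (\<Sum>i<k. i + 2) =
      real q powi (int (n choose 2) - int ((n - k) choose 2) - int k)"
    using hook_exponent[of k n] kn q by (simp add: power_int_diff power_int_of_nat del: of_nat_sum of_nat_mult)
  finally show ?thesis unfolding bracket_sum_by_min[OF k] assms(3) .
qed

end
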